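(* Consider a sequence of community detection problems indexed by $N\to\infty$ with parameters $n,p_0,p_1$ (depending on $N$) satisfying the standing assumptions of the context. Assume that $$\log\Big(1\vee\frac{1}{np_0}\Big)=o\Big[\log\Big(\frac Nn\Big)\Big]$$ and that $n\le N^{1/2-t}$ for some fixed $t>0$. If $$\liminf \frac{n}{\sqrt{N\log N}}\,\frac{(p_1-p_0)^2}{p_0}>2 ,$$ then the relaxed scan test is asymptotically powerful, both when it is calibrated with the true $p_0$ and when it is calibrated with the estimate $\hat p_0$. That is, for each of the choices $\tilde p=p_0$ and $\tilde p=\hat p_0$, there is a sequence of levels $\alpha_N\in(0,1)$ such that the test $T_N$ which rejects ($T_N=1$) if and only if $\pi_N\big(\mathrm{SDP}_n(\boldsymbol W^2),\tilde p\big)\le\alpha_N$ satisfies $\gamma_N(T_N)\to0$, where $\mathrm{SDP}_n$, $\pi_N$ and $\hat p_0$ are defined in the context.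
   Context: Observed data: the adjacency matrix $\boldsymbol{W}=(W_{i,j})\in\{0,1\}^{N\times N}$ (symmetric, zero diagonal) of a random undirected graph on the node set $\{1,\dots,N\}$. Let $0<p_0<p_1\le 1$. Under $\mathbb{P}_0$ (null), the $W_{i,j}$, $i<j$, are i.i.d. Bernoulli$(p_0)$. For $S\subset\{1,\dots,N\}$ with $|S|=n$, under $\mathbb{P}_S$ (alternative), the $W_{i,j}$, $i<j$, are independent, $\mathbb{P}_S(W_{i,j}=1)=p_1$ if $i,j\in S$, and $=p_0$ otherwise. A test $T$ is a function of $\boldsymbol{W}$ with values in $\{0,1\}$, and its risk is $\gamma_N(T)=\mathbb{P}_0(T=1)+\max_{|S|=n}\mathbb{P}_S(T=0)$. Relaxed scan statistic: for a positive semidefinite matrix $\boldsymbol B\in\mathbb{R}^{N\times N}$, $$\mathrm{SDP}_n(\boldsymbol B)=\max_{\boldsymbol Z}\ \mathrm{Trace}(\boldsymbol B\boldsymbol Z)\quad\text{subject to } \boldsymbol Z\succeq0,\ \mathrm{Trace}(\boldsymbol Z)=1,\ |\boldsymbol Z|_1\le n,$$ the maximum being over positive semidefinite $\boldsymbol Z=(Z_{st})\in\mathbb{R}^{N\times N}$, with $|\boldsymbol Z|_1=\sum_{s,t}|Z_{st}|$. The relaxed scan test rejects for large values of $\mathrm{SDP}_n(\boldsymbol W^2)$. Calibration: for $x\in\mathbb{R}$ and $p\in[0,1]$, $\pi_N(x,p)$ is the probability that $\mathrm{SDP}_n(\boldsymbol A^2)\ge x$ where $\boldsymbol A$ is the adjacency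 matrix of an Erdős–Rényi graph on $N$ nodes with connection probability $p$ (the p-value given by Monte Carlo calibration with infinitely many samples). When $p_0$ is known one uses $p=p_0$; when $p_0$ is unknown one uses $p=\hat p_0:=\frac{2}{N(N-1)}\sum_{1\le i<j\le N}W_{i,j}$. Standing assumptions: $N\to\infty$; $n,p_0,p_1$ may depend on $N$; $n/N\to0$; $p_0$ is bounded away from $1$; $N^2p_0\to\infty$; and $n\to\infty$ with $n^2p_1\to\infty$. *)

theory Defs
  imports
    "HOL-Probability.Product_PMF"
    "HOL-Library.Landau_Symbols"
    "Jordan_Normal_Form.Matrix"
begin

section \<open>Random graphs with a planted community\<close>

text \<open>
  The nodes are \<open>0, \<dots>, N - 1\<close>. A graph is encoded by its edge indicators on the pairs
  \<open>(i, j)\<close> with \<open>i < j\<close>.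
\<close>

definition node_pairs :: "nat \<Rightarrow> (nat \<times> nat) set" where
  "node_pairs N = {(i, j). i < j \<and> j < N}"

definition adj_mat :: "nat \<Rightarrow> (nat \<times> nat \<Rightarrow> bool) \<Rightarrow> real mat" where
  "adj_mat N E =
     Matrix.mat N N (\<lambda>(i, j). of_bool (i < j \<and> E (i, j) \<or> j < i \<and> E (j, i)))"

text \<open>Independent edges, the pair \<open>e\<close> being an edge with probability \<open>q e\<close>.\<close>

definition graph_pmf :: "nat \<Rightarrow> (nat \<times> nat \<Rightarrow> real) \<Rightarrow> real mat pmf" where
  "graph_pmf N q =
     map_pmf (adj_mat N) (Pi_pmf (node_pairs N) False (\<lambda>e. bernoulli_pmf (q e)))"

definition erdos_renyi :: "nat \<Rightarrow> real \<Rightarrow> real mat pmf" where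
  "erdos_renyi N p = graph_pmf N (\<lambda>_. p)"

definition planted :: "nat \<Rightarrow> nat set \<Rightarrow> real \<Rightarrow> real \<Rightarrow> real mat pmf" where
  "planted N S p0 p1 = graph_pmf N (\<lambda>(i, j). if i \<in> S \<and> j \<in> S then p1 else p0)"

text \<open>A test is a predicate on adjacency matrices, true meaning rejection of the null.\<close>

definition risk ::
    "nat \<Rightarrow> nat \<Rightarrow> real \<Rightarrow> real \<Rightarrow> (real mat \<Rightarrow> bool) \<Rightarrow> real" where
  "risk N n p0 p1 T =
     measure_pmf.prob (erdos_renyi N p0) {W. T W} +
     Max ((\<lambda>S. measure_pmf.prob (planted N S p0 p1) {W. \<not> T W}) `
            {S. S \<subseteq> {..<N} \<and> card S = n})"


section \<open>The relaxed scan test\<close>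

definition trace_mat :: "real mat \<Rightarrow> real" where
  "trace_mat A = (\<Sum>i<dim_row A. A $$ (i, i))"

definition psd_mat :: "real mat \<Rightarrow> bool" where
  "psd_mat A \<longleftrightarrow> square_mat A \<and> A\<^sup>T = A \<and>
     (\<forall>v \<in> carrier_vec (dim_row A). 0 \<le> scalar_prod v (A *\<^sub>v v))"

definition sdp_feasible :: "nat \<Rightarrow> nat \<Rightarrow> real mat set" where
  "sdp_feasible N n =
     {Z \<in> carrier_mat N N. psd_mat Z \<and> trace_mat Z = 1 \<and> sum_mat (map_mat abs Z) \<le> real n}"

text \<open>
  For \<open>n \<ge> 1\<close> and \<open>B\<close> of positive dimension the feasible set is nonempty and compact,
  so that this supremum is a maximum.
\<close>

definition SDP :: "nat \<Rightarrow> real mat \<Rightarrow> real" where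
  "SDP n B = (SUP Z \<in> sdp_feasible (dim_row B) n. trace_mat (B * Z))"

definition p_value :: "nat \<Rightarrow> nat \<Rightarrow> real \<Rightarrow> real \<Rightarrow> real" where
  "p_value N n x p = measure_pmf.prob (erdos_renyi N p) {A. SDP n (A ^\<^sub>m 2) \<ge> x}"

definition p_hat :: "nat \<Rightarrow> real mat \<Rightarrow> real" where
  "p_hat N W = 2 / (real N * (real N - 1)) * (\<Sum>(i, j) \<in> node_pairs N. W $$ (i, j))"

text \<open>The connection probability used for calibration may depend on the observed matrix.\<close>

definition relaxed_scan_test ::
    "nat \<Rightarrow> nat \<Rightarrow> (real mat \<Rightarrow> real) \<Rightarrow> real \<Rightarrow> real mat \<Rightarrow> bool" where
  "relaxed_scan_test N n pt \<alpha> W \<longleftrightarrow> p_value N n (SDP n (W ^\<^sub>m 2)) (pt W) \<le> \<alpha>"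

end

theory Submission
  imports Defs "HOL-Real_Asymp.Real_Asymp"
begin

text \<open>
  Weak duality gives \<open>SDP n B \<le> max\<^sub>i B\<^sub>i\<^sub>i + (n - 1) max\<^sub>i\<^sub>\<noteq>\<^sub>j \<bar>B\<^sub>i\<^sub>j\<bar>\<close>. For \<open>B = W\<^sup>2\<close> these entries are
  degrees and numbers of common neighbours; under \<open>G(N, p)\<close> Chernoff bounds and a union bound
  over the pairs show that, with probability \<open>1 - O(N powr -\<eta>)\<close>, \<open>SDP n (W\<^sup>2)\<close> is at most
  \<open>N p + n (N p\<^sup>2 + (2 + \<eta>) p sqrt (N ln N))\<close> up to lower order terms. Under the alternative the
  feasible matrix \<open>1\<^sub>S 1\<^sub>S\<^sup>T / n\<close> gives \<open>SDP n (W\<^sup>2) \<ge> \<parallel>W 1\<^sub>S\<parallel>\<^sup>2 / n\<close>, which concentrates around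
  \<open>N p0 + n N p0\<^sup>2 + n\<^sup>2 (p1\<^sup>2 - p0\<^sup>2)\<close>, and \<open>n\<^sup>2 (p1 - p0)\<^sup>2 \<ge> (2 + 2 \<eta>) n p0 sqrt (N ln N)\<close> by
  hypothesis. So the p-value is then polynomially small in \<open>N\<close>, also when calibrated with \<open>p_hat\<close>, which is at most \<open>p0 + 2 w / N\<close> for any
  slowly diverging \<open>w\<close>.

  For the level with \<open>p_hat\<close>: under the null \<open>\<bar>p_hat - p0\<bar> \<le> w sqrt p0 / N\<close> with high
  probability, and for \<open>p\<close> in this window the likelihood ratio of \<open>G(N, p0)\<close> against
  \<open>G(N, p)\<close> has second moment \<open>exp (O(w\<^sup>2))\<close>. By Cauchy-Schwarz, an event of probability \<open>\<alpha>\<close> under \<open>G(N, p)\<close> has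
  probability at most \<open>sqrt \<alpha> exp (O(w\<^sup>2))\<close> under \<open>G(N, p0)\<close>, which tends to \<open>0\<close> when \<open>\<alpha>\<close> is a
  negative power of \<open>N\<close> and \<open>w\<^sup>2 = sqrt (ln N)\<close>.
\<close>

section \<open>Products of independent blocks and exponential tail bounds\<close>

lemma expectation_pair_pmf_prod:
  fixes F :: "'a \<Rightarrow> real" and G :: "'b \<Rightarrow> real"
  assumes "finite (set_pmf p)" "finite (set_pmf q)"
  shows "measure_pmf.expectation (pair_pmf p q) (\<lambda>(x, y). F x * G y) =
         measure_pmf.expectation p F * measure_pmf.expectation q G"
proof -
  have "measure_pmf.expectation (pair_pmf p q) (\<lambda>(x, y). F x * G y) =
        (\<Sum>z\<in>set_pmf p \<times> set_pmf q. (case z of (x, y) \<Rightarrow> F x * G y) * pmf (pair_pmf p q) z)"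
    by (rule integral_measure_pmf_real) (use assms in auto)
  also have "\<dots> = (\<Sum>(x, y)\<in>set_pmf p \<times> set_pmf q. (F x * pmf p x) * (G y * pmf q y))"
    by (intro sum.cong refl) (auto simp: pmf_pair)
  also have "\<dots> = (\<Sum>x\<in>set_pmf p. \<Sum>y\<in>set_pmf q. (F x * pmf p x) * (G y * pmf q y))"
    by (rule sum.cartesian_product[symmetric])
  also have "\<dots> = (\<Sum>x\<in>set_pmf p. F x * pmf p x) * (\<Sum>y\<in>set_pmf q. G y * pmf q y)"
    by (simp add: sum_product)
  also have "\<dots> = measure_pmf.expectation p F * measure_pmf.expectation q G"
    using assms by (subst (1 2) integral_measure_pmf_real[where A = "set_pmf _"]) auto
  finally show ?thesis .
qed

lemma finite_set_Pi_pmf: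
  fixes P :: "'a \<Rightarrow> 'b::finite pmf"
  assumes "finite A"
  shows "finite (set_pmf (Pi_pmf A d P))"
  using assms by (auto simp: set_Pi_pmf)

text \<open>Splitting the product measure into the coordinates in \<open>L\<close> and the remaining
  ones makes \<open>F\<close> a function of the first factor and \<open>G\<close> of the second.
  Dependence on a block is phrased as invariance under changes off the block.\<close>

lemma expectation_Pi_pmf_indep:
  fixes P :: "'a \<Rightarrow> 'b::finite pmf" and F G :: "('a \<Rightarrow> 'b) \<Rightarrow> real"
  assumes "finite A" "L \<subseteq> A" "L \<inter> L' = {}"
    and F: "\<And>f g. (\<And>x. x \<in> L \<Longrightarrow> f x = g x) \<Longrightarrow> F f = F g"
    and G: "\<And>f g. (\<And>x. x \<in> L' \<Longrightarrow> f x = g x) \<Longrightarrow> G f = G g"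
  shows "measure_pmf.expectation (Pi_pmf A d P) (\<lambda>f. F f * G f) =
         measure_pmf.expectation (Pi_pmf A d P) F * measure_pmf.expectation (Pi_pmf A d P) G"
proof -
  let ?P = "Pi_pmf L d P" and ?Q = "Pi_pmf (A - L) d P"
  let ?h = "\<lambda>(f, g) x. if x \<in> L then f x else g x"
  have A: "Pi_pmf A d P = map_pmf ?h (pair_pmf ?P ?Q)"
    using Pi_pmf_union[of L "A - L" d P] assms(1,2)
    by (simp add: Un_absorb1 Un_Diff_cancel finite_subset)
  have fin: "finite (set_pmf ?P)" "finite (set_pmf ?Q)"
    using assms(1,2) by (auto intro!: finite_set_Pi_pmf intro: finite_subset)
  have F': "F (?h z) = F (fst z)" for z by (rule F) (auto split: prod.splits)
  have G': "G (?h z) = G (snd z)" for z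
    by (rule G) (use assms(3) in \<open>auto split: prod.splits\<close>)
  have 1: "measure_pmf.expectation (Pi_pmf A d P) (\<lambda>f. F f * G f) =
      measure_pmf.expectation ?P F * measure_pmf.expectation ?Q G"
    unfolding A expectation_pair_pmf_prod[OF fin, symmetric]
    by (simp only: integral_map_pmf F' G') (simp add: case_prod_unfold)
  have 2: "measure_pmf.expectation (Pi_pmf A d P) F = measure_pmf.expectation ?P F"
    unfolding A by (simp only: integral_map_pmf F' expectation_pair_pmf_fst)
  have 3: "measure_pmf.expectation (Pi_pmf A d P) G = measure_pmf.expectation ?Q G"
    unfolding A by (simp only: integral_map_pmf G' expectation_pair_pmf_snd)
  show ?thesis using 1 2 3 by simp
qed

text \<open>Induction on \<open>K\<close>, peeling off one block against the union of the others.
  This factorises the exponential moments of edge counts, codegrees and sums of squared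
  degrees.\<close>

lemma expectation_Pi_pmf_blocks:
  fixes P :: "'a \<Rightarrow> 'b::finite pmf" and G :: "'k \<Rightarrow> ('a \<Rightarrow> 'b) \<Rightarrow> real"
  assumes "finite A" "finite K" "\<And>k. k \<in> K \<Longrightarrow> L k \<subseteq> A" "disjoint_family_on L K"
    and "\<And>k f g. k \<in> K \<Longrightarrow> (\<And>x. x \<in> L k \<Longrightarrow> f x = g x) \<Longrightarrow> G k f = G k g"
  shows "measure_pmf.expectation (Pi_pmf A d P) (\<lambda>f. \<Prod>k\<in>K. G k f) =
         (\<Prod>k\<in>K. measure_pmf.expectation (Pi_pmf A d P) (G k))"
  using assms(2-5)
proof (induction K rule: finite_induct)
  case (insert k K)
  have "measure_pmf.expectation (Pi_pmf A d P) (\<lambda>f. G k f * (\<Prod>k\<in>K. G k f)) =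
     measure_pmf.expectation (Pi_pmf A d P) (G k) *
     measure_pmf.expectation (Pi_pmf A d P) (\<lambda>f. \<Prod>k\<in>K. G k f)"
  proof (rule expectation_Pi_pmf_indep[OF assms(1), where L' = "\<Union> (L ` K)"])
    show "L k \<subseteq> A" by (rule insert.prems(1)) simp
    show "L k \<inter> \<Union> (L ` K) = {}"
    proof -
      have "L k \<inter> L j = {}" if "j \<in> K" for j
        by (rule disjoint_family_onD[OF insert.prems(2)]) (use that insert.hyps in auto)
      then show ?thesis by auto
    qed
    show "(\<Prod>k\<in>K. G k f) = (\<Prod>k\<in>K. G k g)" if "\<And>x. x \<in> \<Union> (L ` K) \<Longrightarrow> f x = g x" for f g
      by (intro prod.cong refl insert.prems(3)) (simp, rule that, blast)
    show "G k f = G k g" if "\<And>x. x \<in> L k \<Longrightarrow> f x = g x" for f g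
      by (rule insert.prems(3)[OF insertI1 that])
  qed
  moreover have "measure_pmf.expectation (Pi_pmf A d P) (\<lambda>f. \<Prod>k\<in>K. G k f) =
      (\<Prod>k\<in>K. measure_pmf.expectation (Pi_pmf A d P) (G k))"
  proof (rule insert.IH)
    show "L j \<subseteq> A" if "j \<in> K" for j by (rule insert.prems(1)) (use that in simp)
    show "disjoint_family_on L K"
      using insert.prems(2) by (rule disjoint_family_on_mono[rotated]) auto
    show "G j f = G j g" if "j \<in> K" "\<And>x. x \<in> L j \<Longrightarrow> f x = g x" for j f g
      by (rule insert.prems(3)[OF insertI2[OF that(1)] that(2)])
  qed
  ultimately show ?case
    using insert.hyps by simp
qed simp

section \<open>Chernoff bounds from Poisson-type moment generating functions\<close>

lemma chernoff_ge:
  fixes M :: "'a pmf" and X :: "'a \<Rightarrow> real"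
  assumes "finite (set_pmf M)" "0 \<le> l"
  shows "measure_pmf.prob M {x. a \<le> X x} \<le>
         exp (- l * a) * measure_pmf.expectation M (\<lambda>x. exp (l * X x))"
proof -
  have "measure_pmf.prob M {x. a \<le> X x} = measure_pmf.expectation M (indicator {x. a \<le> X x})"
    by simp
  also have "\<dots> \<le> measure_pmf.expectation M (\<lambda>x. exp (- l * a) * exp (l * X x))"
  proof (rule integral_mono)
    show "indicator {x. a \<le> X x} x \<le> exp (- l * a) * exp (l * X x)" for x
      using mult_left_mono[of a "X x" l] assms(2)
      by (auto simp: indicator_def simp flip: exp_add)
  qed (use assms in \<open>auto intro!: integrable_measure_pmf_finite\<close>)
  finally show ?thesis by simp
qed

text \<open>The leading coefficient 1/2 has to be sharp: the codegree threshold
  \<open>(2 + \<eta>) p sqrt (N ln N)\<close> only just beats a union bound over the pairs of nodes.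
  The difference of the two sides is increasing by the cruder bound
  \<open>exp y \<le> 1 + y + y^2\<close>.\<close>

lemma exp_le_quadratic:
  fixes x :: real
  assumes "0 \<le> x" "x \<le> 1"
  shows "exp x \<le> 1 + x + x\<^sup>2 / 2 * (1 + x)"
proof -
  let ?f = "\<lambda>x::real. 1 + x + x\<^sup>2 / 2 * (1 + x) - exp x"
  have *: "exp y \<le> 1 + y + y\<^sup>2" if "0 \<le> y" "y \<le> 1" for y :: real
    using exp_bound[OF that] .
  have "?f 0 \<le> ?f x"
  proof (rule DERIV_nonneg_imp_nondecreasing[OF assms(1)])
    fix y assume y: "0 \<le> y" "y \<le> x"
    have "(?f has_real_derivative (1 + y + 3/2 * y\<^sup>2 - exp y)) (at y)"
      by (auto intro!: derivative_eq_intros simp: power2_eq_square field_simps)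
    moreover have "0 \<le> 1 + y + 3/2 * y\<^sup>2 - exp y"
      using *[of y] y assms zero_le_power2[of y] by linarith
    ultimately show "\<exists>d. (?f has_real_derivative d) (at y) \<and> 0 \<le> d" by blast
  qed
  then show ?thesis by simp
qed

lemma exp_minus_le_quadratic:
  fixes x :: real
  assumes "0 \<le> x"
  shows "exp (- x) \<le> 1 - x + x\<^sup>2 / 2"
proof -
  let ?f = "\<lambda>x::real. 1 - x + x\<^sup>2 / 2 - exp (- x)"
  have "?f 0 \<le> ?f x"
  proof (rule DERIV_nonneg_imp_nondecreasing[OF assms(1)])
    fix y :: real assume y: "0 \<le> y" "y \<le> x"
    have "(?f has_real_derivative (y - 1 + exp (-y))) (at y)"
      by (auto intro!: derivative_eq_intros)
    moreover have "0 \<le> y - 1 + exp (-y)" using exp_ge_add_one_self[of "-y"] by simp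
    ultimately show "\<exists>d. (?f has_real_derivative d) (at y) \<and> 0 \<le> d" by blast
  qed
  then show ?thesis by simp
qed

text \<open>
  Letting \<open>\<nu>\<close> differ from \<open>\<mu>\<close> gives tails that are uniform over an upper bound on the mean.
\<close>

lemma poisson_upper_tail:
  fixes M :: "'a pmf" and X :: "'a \<Rightarrow> real"
  assumes "finite (set_pmf M)"
    and mgf: "\<And>l. 0 \<le> l \<Longrightarrow> measure_pmf.expectation M (\<lambda>x. exp (l * X x)) \<le> exp (\<mu> * (exp l - 1))"
    and "0 \<le> \<mu>" "\<mu> \<le> \<nu>" "0 < \<nu>" "0 \<le> s" "s \<le> \<nu>"
  shows "measure_pmf.prob M {x. \<mu> + s \<le> X x} \<le> exp (- (s\<^sup>2 / (2 * \<nu>)) * (1 - s / \<nu>))"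
proof -
  \<comment> \<open>The minimiser of \<open>- l * s + \<nu> * l^2 / 2\<close>. The cubic error term
    of the exponential then produces the factor \<open>1 - s / \<nu>\<close>, and
    \<open>s \<le> \<nu>\<close> keeps \<open>l\<close> in the range of
    \<open>exp_le_quadratic\<close>.\<close>
  define l where "l = s / \<nu>"
  have l: "0 \<le> l" "l \<le> 1" using assms by (auto simp: l_def)
  have s: "s = l * \<nu>" using assms by (simp add: l_def)
  have "measure_pmf.prob M {x. \<mu> + s \<le> X x} \<le> exp (- l * (\<mu> + s)) * exp (\<mu> * (exp l - 1))"
    by (rule order_trans[OF chernoff_ge[OF assms(1) l(1)]]) (intro mult_left_mono mgf l, simp)
  also have "\<dots> = exp (- l * s + \<mu> * (exp l - 1 - l))"
    by (simp add: algebra_simps flip: exp_add)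
  also have "\<dots> \<le> exp (- l * s + \<nu> * (l\<^sup>2 / 2 * (1 + l)))"
  proof -
    \<comment> \<open>The shift by \<open>\<mu>\<close> has been absorbed into the linear term, so
      the mean multiplies only a nonnegative quantity and may be raised to
      \<open>\<nu>\<close>.\<close>
    have "\<mu> * (exp l - 1 - l) \<le> \<nu> * (l\<^sup>2 / 2 * (1 + l))"
    proof (rule mult_mono)
      show "exp l - 1 - l \<le> l\<^sup>2 / 2 * (1 + l)" "0 \<le> exp l - 1 - l"
        using exp_le_quadratic[OF l] exp_ge_add_one_self[of l] by linarith+
    qed (use assms in auto)
    then show ?thesis by simp
  qed
  also have "- l * s + \<nu> * (l\<^sup>2 / 2 * (1 + l)) = - (s\<^sup>2 / (2 * \<nu>)) * (1 - s / \<nu>)"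
    unfolding s using assms by (simp add: field_simps power2_eq_square)
  finally show ?thesis .
qed

text \<open>The quadratic bound on \<open>exp (- x)\<close> holds on the whole half line, so here
  the exponent carries no correction factor and \<open>s\<close> may be arbitrarily large.\<close>

lemma poisson_lower_tail:
  fixes M :: "'a pmf" and X :: "'a \<Rightarrow> real"
  assumes "finite (set_pmf M)"
    and mgf: "\<And>l. measure_pmf.expectation M (\<lambda>x. exp (l * X x)) \<le> exp (\<mu> * (exp l - 1))"
    and "0 < \<mu>" "0 \<le> s"
  shows "measure_pmf.prob M {x. X x \<le> \<mu> - s} \<le> exp (- (s\<^sup>2 / (2 * \<mu>)))"
proof -
  define l where "l = s / \<mu>"
  have l: "0 \<le> l" using assms by (auto simp: l_def)
  have s: "s = l * \<mu>" using assms by (simp add: l_def)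
  have "measure_pmf.prob M {x. X x \<le> \<mu> - s} = measure_pmf.prob M {x. s - \<mu> \<le> - X x}"
    by (rule arg_cong[where f = "measure_pmf.prob M"]) auto
  also have "\<dots> \<le> exp (- l * (s - \<mu>)) * measure_pmf.expectation M (\<lambda>x. exp (l * - X x))"
    by (rule chernoff_ge[OF assms(1) l(1)])
  also have "\<dots> \<le> exp (- l * (s - \<mu>)) * exp (\<mu> * (exp (-l) - 1))"
    using mgf[of "-l"] by simp
  also have "\<dots> = exp (- l * s + \<mu> * (exp (-l) - 1 + l))"
    by (simp add: algebra_simps flip: exp_add)
  also have "\<dots> \<le> exp (- l * s + \<mu> * (l\<^sup>2 / 2))"
    using mult_left_mono[OF exp_minus_le_quadratic[OF l], of \<mu>] assms(3)
    by (simp add: algebra_simps)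
  also have "- l * s + \<mu> * (l\<^sup>2 / 2) = - (s\<^sup>2 / (2 * \<mu>))"
    unfolding s using assms by (simp add: field_simps power2_eq_square)
  finally show ?thesis .
qed

section \<open>Bounds on the semidefinite program\<close>

lemma trace_mat_mult:
  assumes "B \<in> carrier_mat N N" "Z \<in> carrier_mat N N"
  shows "trace_mat (B * Z) = (\<Sum>i<N. \<Sum>k<N. B $$ (i, k) * Z $$ (k, i))"
  using assms unfolding trace_mat_def
  by (auto simp: scalar_prod_def atLeast0LessThan intro!: sum.cong)

lemma psd_mat_diag_nonneg:
  assumes "psd_mat Z" "Z \<in> carrier_mat N N" "i < N"
  shows "0 \<le> Z $$ (i, i)"
proof -
  have "0 \<le> scalar_prod (unit_vec N i) (Z *\<^sub>v unit_vec N i)"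
    using assms unfolding psd_mat_def by (metis carrier_matD(1) unit_vec_carrier)
  also have "\<dots> = vec_index (Z *\<^sub>v unit_vec N i) i"
    using assms by (intro scalar_prod_left_unit) auto
  also have "\<dots> = Z $$ (i, i)"
    using assms by simp
  finally show ?thesis .
qed

text \<open>The diagonal of \<open>Z\<close> is nonnegative with sum 1, so the diagonal of
  \<open>B\<close> contributes a weighted average. It also uses up 1 of the entrywise norm, which
  leaves at most \<open>n - 1\<close> for the entries off the diagonal.\<close>

lemma trace_mult_le:
  assumes B: "B \<in> carrier_mat N N" and Z: "Z \<in> sdp_feasible N n"
    and D: "\<And>i. i < N \<Longrightarrow> B $$ (i, i) \<le> D"
    and C: "\<And>i j. i < N \<Longrightarrow> j < N \<Longrightarrow> i \<noteq> j \<Longrightarrow> \<bar>B $$ (i, j)\<bar> \<le> C" and "0 \<le> C"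
  shows "trace_mat (B * Z) \<le> D + (real n - 1) * C"
proof -
  have cZ: "Z \<in> carrier_mat N N" and psd: "psd_mat Z" and tr: "trace_mat Z = 1"
    and l1: "sum_mat (map_mat abs Z) \<le> real n"
    using Z by (auto simp: sdp_feasible_def)
  have pos: "0 \<le> Z $$ (i, i)" if "i < N" for i
    by (rule psd_mat_diag_nonneg[OF psd cZ that])
  have tr': "(\<Sum>i<N. Z $$ (i, i)) = 1" using tr cZ by (simp add: trace_mat_def)
  have "sum_mat (map_mat abs Z) = (\<Sum>ij\<in>{..<N} \<times> {..<N}. \<bar>Z $$ ij\<bar>)"
    using cZ unfolding sum_mat_def by (auto simp: atLeast0LessThan intro!: sum.cong)
  also have "\<dots> = (\<Sum>i<N. \<Sum>k<N. \<bar>Z $$ (i, k)\<bar>)"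
    by (simp add: sum.cartesian_product)
  also have "\<dots> = (\<Sum>i<N. \<Sum>k<N. \<bar>Z $$ (k, i)\<bar>)" by (rule sum.swap)
  also have "\<dots> = (\<Sum>i<N. \<bar>Z $$ (i, i)\<bar> + (\<Sum>k\<in>{..<N} - {i}. \<bar>Z $$ (k, i)\<bar>))"
    by (intro sum.cong refl) (simp add: sum.remove)
  also have "\<dots> = 1 + (\<Sum>i<N. \<Sum>k\<in>{..<N} - {i}. \<bar>Z $$ (k, i)\<bar>)"
    using pos tr' by (simp add: sum.distrib)
  finally have off: "(\<Sum>i<N. \<Sum>k\<in>{..<N} - {i}. \<bar>Z $$ (k, i)\<bar>) \<le> real n - 1" using l1 by simp
  have "trace_mat (B * Z) = (\<Sum>i<N. B $$ (i, i) * Z $$ (i, i) + (\<Sum>k\<in>{..<N} - {i}. B $$ (i, k) * Z $$ (k, i)))"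
    unfolding trace_mat_mult[OF B cZ] by (intro sum.cong refl) (simp add: sum.remove)
  also have "\<dots> = (\<Sum>i<N. B $$ (i, i) * Z $$ (i, i)) + (\<Sum>i<N. \<Sum>k\<in>{..<N} - {i}. B $$ (i, k) * Z $$ (k, i))"
    by (rule sum.distrib)
  also have "\<dots> \<le> (\<Sum>i<N. D * Z $$ (i, i)) + (\<Sum>i<N. \<Sum>k\<in>{..<N} - {i}. C * \<bar>Z $$ (k, i)\<bar>)"
  proof (intro add_mono sum_mono)
    show "B $$ (i, i) * Z $$ (i, i) \<le> D * Z $$ (i, i)" if "i \<in> {..<N}" for i
      using that D pos by (simp add: mult_right_mono)
    show "B $$ (i, k) * Z $$ (k, i) \<le> C * \<bar>Z $$ (k, i)\<bar>"
      if "i \<in> {..<N}" "k \<in> {..<N} - {i}" for i k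
    proof -
      have "B $$ (i, k) * Z $$ (k, i) \<le> \<bar>B $$ (i, k)\<bar> * \<bar>Z $$ (k, i)\<bar>"
        by (metis abs_ge_self abs_mult)
      also have "\<dots> \<le> C * \<bar>Z $$ (k, i)\<bar>" using that C by (simp add: mult_right_mono)
      finally show ?thesis .
    qed
  qed
  also have "\<dots> = D + C * (\<Sum>i<N. \<Sum>k\<in>{..<N} - {i}. \<bar>Z $$ (k, i)\<bar>)"
    using tr' by (simp add: sum_distrib_left[symmetric])
  also have "\<dots> \<le> D + C * (real n - 1)"
    using off \<open>0 \<le> C\<close> by (simp add: mult_left_mono)
  finally show ?thesis by (simp add: mult.commute)
qed

text \<open>Division by \<open>n\<close> makes the trace 1, and the entrywise norm
  \<open>n^2 / n\<close> then exhausts the constraint exactly.\<close>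

lemma indicator_mat_feasible:
  assumes "S \<subseteq> {..<N}" "card S = n" "0 < n"
  shows "Matrix.mat N N (\<lambda>(i, j). of_bool (i \<in> S \<and> j \<in> S) / real n) \<in> sdp_feasible N n"
    (is "?Z \<in> _")
proof -
  have fin: "finite S" using assms(1) finite_subset by blast
  have S: "{..<N} \<inter> S = S" using assms(1) by auto
  have Z: "?Z \<in> carrier_mat N N" by simp
  have "trace_mat ?Z = (\<Sum>i<N. of_bool (i \<in> S) / real n)"
    by (simp add: trace_mat_def)
  also have "\<dots> = 1" using assms S
    by (simp add: of_bool_def sum.If_cases fin flip: sum_divide_distrib)
  finally have tr: "trace_mat ?Z = 1" .
  have "sum_mat (map_mat abs ?Z) = (\<Sum>ij\<in>{..<N} \<times> {..<N}. of_bool (ij \<in> S \<times> S) / real n)"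
    unfolding sum_mat_def by (auto simp: atLeast0LessThan intro!: sum.cong)
  also have "\<dots> = real (card (S \<times> S)) / real n"
  proof -
    have "({..<N} \<times> {..<N}) \<inter> S \<times> S = S \<times> S" using assms(1) by auto
    then show ?thesis
      by (simp add: of_bool_def sum.If_cases fin flip: sum_divide_distrib)
  qed
  also have "\<dots> = real n" using assms by (simp add: card_cartesian_product)
  finally have l1: "sum_mat (map_mat abs ?Z) \<le> real n" by simp
  have "0 \<le> scalar_prod v (?Z *\<^sub>v v)" if v: "v \<in> carrier_vec N" for v
  proof -
    have dv: "dim_vec v = N" using v by simp
    have "scalar_prod v (?Z *\<^sub>v v) =
        (\<Sum>i<N. \<Sum>j<N. vec_index v i * (of_bool (i \<in> S \<and> j \<in> S) / real n * vec_index v j))"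
      using dv by (simp add: scalar_prod_def atLeast0LessThan sum_distrib_left)
    \<comment> \<open>The indicator of \<open>S\<close> times \<open>S\<close> factorises, which
      turns the quadratic form into a square.\<close>
    also have "\<dots> = (\<Sum>i<N. \<Sum>j<N. (of_bool (i \<in> S) * vec_index v i) * (of_bool (j \<in> S) * vec_index v j) / real n)"
      by (intro sum.cong refl) (auto simp: field_simps)
    also have "\<dots> = (\<Sum>i<N. of_bool (i \<in> S) * vec_index v i)\<^sup>2 / real n"
      unfolding power2_eq_square sum_product by (simp only: sum_divide_distrib)
    finally show ?thesis by simp
  qed
  moreover have "?Z\<^sup>T = ?Z" by (rule eq_matI) (auto simp: conj_commute)
  ultimately have "psd_mat ?Z" by (auto simp: psd_mat_def)
  then show ?thesis using tr l1 by (simp add: sdp_feasible_def)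
qed

lemma SDP_le:
  assumes B: "B \<in> carrier_mat N N" and n: "0 < n" "n \<le> N"
    and D: "\<And>i. i < N \<Longrightarrow> B $$ (i, i) \<le> D"
    and C: "\<And>i j. i < N \<Longrightarrow> j < N \<Longrightarrow> i \<noteq> j \<Longrightarrow> \<bar>B $$ (i, j)\<bar> \<le> C" and "0 \<le> C"
  shows "SDP n B \<le> D + (real n - 1) * C"
proof -
  \<comment> \<open>A supremum of reals is bounded by a common upper bound only over a nonempty set;
    any \<open>n\<close> nodes provide a feasible point.\<close>
  have "sdp_feasible N n \<noteq> {}"
    using indicator_mat_feasible[of "{..<n}" N n] n by auto
  then show ?thesis
    unfolding SDP_def using B trace_mult_le[OF B _ D C \<open>0 \<le> C\<close>]
    by (auto intro!: cSUP_least)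
qed

lemma SDP_ge:
  assumes B: "B \<in> carrier_mat N N" and S: "S \<subseteq> {..<N}" "card S = n" "0 < n"
  shows "(\<Sum>i\<in>S. \<Sum>j\<in>S. B $$ (i, j)) / real n \<le> SDP n B"
proof -
  \<comment> \<open>A crude bound on every entry. It serves only to make the objective bounded above
    on the feasible set, so that the supremum dominates each of its values.\<close>
  define K where "K = (\<Sum>ij\<in>{..<N} \<times> {..<N}. \<bar>B $$ ij\<bar>)"
  have K: "\<bar>B $$ (i, j)\<bar> \<le> K" if "i < N" "j < N" for i j
    unfolding K_def by (rule member_le_sum) (use that in auto)
  have K0: "0 \<le> K" unfolding K_def by (intro sum_nonneg) auto
  have bdd: "bdd_above ((\<lambda>Z. trace_mat (B * Z)) ` sdp_feasible (dim_row B) n)"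
  proof (rule bdd_aboveI2)
    fix Z assume "Z \<in> sdp_feasible (dim_row B) n"
    then show "trace_mat (B * Z) \<le> K + (real n - 1) * K"
      using B by (intro trace_mult_le[OF B]) (auto intro: K order_trans[OF abs_ge_self K] simp: K0)
  qed
  let ?Z = "Matrix.mat N N (\<lambda>(i, j). of_bool (i \<in> S \<and> j \<in> S) / real n)"
  have fin: "finite S" using S(1) finite_subset by blast
  have "trace_mat (B * ?Z) = (\<Sum>i<N. \<Sum>k<N. if i \<in> S then if k \<in> S then B $$ (i, k) / real n else 0 else 0)"
    by (subst trace_mat_mult[OF B]) (auto intro!: sum.cong)
  also have "\<dots> = (\<Sum>i<N. if i \<in> S then (\<Sum>k<N. if k \<in> S then B $$ (i, k) / real n else 0) else 0)"
    by (intro sum.cong refl) auto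
  also have "\<dots> = (\<Sum>i\<in>S. \<Sum>k\<in>S. B $$ (i, k) / real n)"
    using S(1) by (simp add: sum.inter_restrict[symmetric] Int_absorb1)
  also have "\<dots> = (\<Sum>i\<in>S. \<Sum>j\<in>S. B $$ (i, j)) / real n"
    by (simp flip: sum_divide_distrib)
  finally have "trace_mat (B * ?Z) = (\<Sum>i\<in>S. \<Sum>j\<in>S. B $$ (i, j)) / real n" .
  moreover have "trace_mat (B * ?Z) \<le> SDP n B"
    unfolding SDP_def using indicator_mat_feasible[OF S] B
    by (intro cSUP_upper[OF _ bdd]) auto
  ultimately show ?thesis by simp
qed

section \<open>Entries of the squared adjacency matrix as degrees and codegrees\<close>

text \<open>Edge indicators live on pairs with the smaller node first; sorting lets both endpoints
  address the same indicator.\<close>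

definition edge :: "nat \<Rightarrow> nat \<Rightarrow> nat \<times> nat" where
  "edge i j = (min i j, max i j)"

lemma edge_commute: "edge i j = edge j i"
  by (simp add: edge_def min.commute max.commute)

lemma edge_in_node_pairs: "i < N \<Longrightarrow> j < N \<Longrightarrow> i \<noteq> j \<Longrightarrow> edge i j \<in> node_pairs N"
  by (auto simp: edge_def node_pairs_def min_def max_def)

lemma edge_eq_iff: "edge i j = edge k l \<longleftrightarrow> i = k \<and> j = l \<or> i = l \<and> j = k"
  by (auto simp: edge_def min_def max_def split: if_splits)

lemma finite_node_pairs: "finite (node_pairs N)"
  by (rule finite_subset[of _ "{..<N} \<times> {..<N}"]) (auto simp: node_pairs_def)

lemma card_node_pairs: "2 * card (node_pairs N) = N * (N - 1)"
proof (induction N)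
  case (Suc N)
  have "node_pairs (Suc N) = node_pairs N \<union> (\<lambda>i. (i, N)) ` {..<N}"
    by (auto simp: node_pairs_def)
  moreover have "card (node_pairs N \<union> (\<lambda>i. (i, N)) ` {..<N}) = card (node_pairs N) + N"
    by (subst card_Un_disjoint) (auto simp: finite_node_pairs card_image inj_on_def, auto simp: node_pairs_def)
  ultimately show ?case using Suc by (cases N) (auto simp: algebra_simps)
qed (simp add: node_pairs_def)

lemma adj_mat_index:
  "i < N \<Longrightarrow> j < N \<Longrightarrow> adj_mat N E $$ (i, j) = of_bool (i \<noteq> j \<and> E (edge i j))"
  by (auto simp: adj_mat_def edge_def min_def max_def)

lemma adj_mat_carrier [simp]: "adj_mat N E \<in> carrier_mat N N"
  by (simp add: adj_mat_def)

lemma pow2_index: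
  assumes "A \<in> carrier_mat N N" "i < N" "j < N"
  shows "(A ^\<^sub>m 2) $$ (i, j) = (\<Sum>k<N. A $$ (i, k) * A $$ (k, j))"
  using assms by (simp add: numeral_2_eq_2 scalar_prod_def atLeast0LessThan)

definition degree_in :: "nat \<Rightarrow> nat set \<Rightarrow> (nat \<times> nat \<Rightarrow> bool) \<Rightarrow> real" where
  "degree_in k S E = (\<Sum>i\<in>S - {k}. of_bool (E (edge k i)))"

definition codegree :: "nat \<Rightarrow> nat \<Rightarrow> nat \<Rightarrow> (nat \<times> nat \<Rightarrow> bool) \<Rightarrow> real" where
  "codegree N i j E = (\<Sum>k\<in>{..<N} - {i, j}. of_bool (E (edge i k)) * of_bool (E (edge j k)))"

lemma adj_square_diag: "i < N \<Longrightarrow> (adj_mat N E ^\<^sub>m 2) $$ (i, i) = degree_in i {..<N} E"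
  unfolding degree_in_def
  by (subst pow2_index[where N = N], simp_all only: adj_mat_carrier,
      intro sum.mono_neutral_cong_right)
     (auto simp: adj_mat_index edge_commute[of _ i])

lemma adj_square_off_diag:
  "i < N \<Longrightarrow> j < N \<Longrightarrow> i \<noteq> j \<Longrightarrow> (adj_mat N E ^\<^sub>m 2) $$ (i, j) = codegree N i j E"
  unfolding codegree_def
  by (subst pow2_index[where N = N], simp_all only: adj_mat_carrier,
      intro sum.mono_neutral_cong_right)
     (auto simp: adj_mat_index edge_commute[of _ j])

lemma SDP_adj_le:
  assumes "0 < n" "n \<le> N" "0 \<le> C"
    and "\<And>i. i < N \<Longrightarrow> degree_in i {..<N} E \<le> D"
    and "\<And>i j. i < N \<Longrightarrow> j < N \<Longrightarrow> i \<noteq> j \<Longrightarrow> codegree N i j E \<le> C"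
  shows "SDP n (adj_mat N E ^\<^sub>m 2) \<le> D + (real n - 1) * C"
proof -
  have "0 \<le> codegree N i j E" for i j unfolding codegree_def by (intro sum_nonneg) auto
  then show ?thesis
    using assms by (intro SDP_le[where N = N]) (auto simp: adj_square_diag adj_square_off_diag)
qed

text \<open>By symmetry of \<open>W\<close>, summing \<open>W^2\<close> over \<open>S\<close> times
  \<open>S\<close> gives the squared norm of \<open>W\<close> applied to the indicator vector of
  \<open>S\<close>, whose coordinates are the degrees into \<open>S\<close>.\<close>

lemma SDP_adj_ge:
  assumes S: "S \<subseteq> {..<N}" "card S = n" "0 < n"
  shows "(\<Sum>k<N. (degree_in k S E)\<^sup>2) / real n \<le> SDP n (adj_mat N E ^\<^sub>m 2)"
proof -
  let ?W = "adj_mat N E"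
  have fin: "finite S" using S(1) finite_subset by blast
  have W: "(\<Sum>i\<in>S. ?W $$ (k, i)) = degree_in k S E" if "k < N" for k
    unfolding degree_in_def using S(1) that fin
    by (intro sum.mono_neutral_cong_right) (auto simp: adj_mat_index subset_iff)
  have "(\<Sum>i\<in>S. \<Sum>j\<in>S. (?W ^\<^sub>m 2) $$ (i, j)) = (\<Sum>i\<in>S. \<Sum>j\<in>S. \<Sum>k<N. ?W $$ (k, i) * ?W $$ (k, j))"
  proof (intro sum.cong refl)
    fix i j assume "i \<in> S" "j \<in> S"
    then have ij: "i < N" "j < N" using S(1) by auto
    show "(?W ^\<^sub>m 2) $$ (i, j) = (\<Sum>k<N. ?W $$ (k, i) * ?W $$ (k, j))"
      unfolding pow2_index[OF adj_mat_carrier ij]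
      by (intro sum.cong refl arg_cong2[where f = "(*)"])
         (use ij in \<open>simp_all add: adj_mat_index edge_commute[of i] eq_commute[of i]\<close>)
  qed
  also have "\<dots> = (\<Sum>i\<in>S. \<Sum>k<N. \<Sum>j\<in>S. ?W $$ (k, i) * ?W $$ (k, j))"
    by (intro sum.cong refl sum.swap)
  also have "\<dots> = (\<Sum>k<N. \<Sum>i\<in>S. \<Sum>j\<in>S. ?W $$ (k, i) * ?W $$ (k, j))"
    by (rule sum.swap)
  also have "\<dots> = (\<Sum>k<N. (degree_in k S E)\<^sup>2)"
    by (intro sum.cong refl) (simp add: power2_eq_square W flip: sum_product)
  finally show ?thesis using SDP_ge[OF _ S, of "?W ^\<^sub>m 2"] by simp
qed

text \<open>Applied to the degrees into \<open>S\<close>: those of outside nodes are independent and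
  keep their squares, while those of inside nodes share edges and are merged by Cauchy-Schwarz into
  their total, which is a sum of independent indicators.\<close>

lemma sum_squares_split:
  fixes x :: "nat \<Rightarrow> real"
  assumes "S \<subseteq> {..<N}" "card S = n" "0 < n"
  shows "(\<Sum>k\<in>{..<N} - S. (x k)\<^sup>2) + (\<Sum>k\<in>S. x k)\<^sup>2 / real n \<le> (\<Sum>k<N. (x k)\<^sup>2)"
proof -
  have fin: "finite S" using assms(1) finite_subset by blast
  have "(\<Sum>k\<in>S. x k)\<^sup>2 \<le> (\<Sum>k\<in>S. (x k)\<^sup>2) * real n"
    using sum_squared_le_sum_of_squares[of x S] assms by simp
  then have "(\<Sum>k\<in>S. x k)\<^sup>2 / real n \<le> (\<Sum>k\<in>S. (x k)\<^sup>2)"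
    using assms by (simp add: field_simps)
  then show ?thesis
    using sum.subset_diff[OF assms(1), of "\<lambda>k. (x k)\<^sup>2"] by simp
qed

text \<open>Handshake identity for the subgraph induced by \<open>S\<close>: the ordered pairs of
  distinct nodes split into the increasing ones and their mirror images.\<close>

lemma sum_degree_in:
  assumes "S \<subseteq> {..<N}"
  shows "(\<Sum>k\<in>S. degree_in k S E) = 2 * (\<Sum>e\<in>node_pairs N \<inter> S \<times> S. of_bool (E e))"
proof -
  have fin: "finite S" using assms(1) finite_subset by blast
  let ?A = "node_pairs N \<inter> S \<times> S"
  have "(\<Sum>k\<in>S. degree_in k S E) = (\<Sum>(k, i)\<in>Sigma S (\<lambda>k. S - {k}). of_bool (E (edge k i)))"
    unfolding degree_in_def by (rule sum.Sigma) (use fin in auto)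
  also have "Sigma S (\<lambda>k. S - {k}) = ?A \<union> prod.swap ` ?A"
  proof (intro equalityI subsetI)
    fix e assume "e \<in> Sigma S (\<lambda>k. S - {k})"
    then obtain a b where e: "e = (a, b)" "a \<in> S" "b \<in> S" "a \<noteq> b" by auto
    show "e \<in> ?A \<union> prod.swap ` ?A"
    proof (cases "a < b")
      case False
      then have "(b, a) \<in> ?A" using e assms by (auto simp: node_pairs_def)
      then show ?thesis unfolding e by (metis UnI2 image_eqI swap_simp)
    qed (use e assms in \<open>auto simp: node_pairs_def\<close>)
  qed (auto simp: node_pairs_def)
  also have "(\<Sum>(k, i)\<in>\<dots>. of_bool (E (edge k i)) :: real) =
      (\<Sum>(k, i)\<in>?A. of_bool (E (edge k i))) + (\<Sum>(k, i)\<in>prod.swap ` ?A. of_bool (E (edge k i)))"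
    by (rule sum.union_disjoint) (use finite_node_pairs in \<open>auto simp: node_pairs_def\<close>)
  also have "(\<Sum>(k, i)\<in>prod.swap ` ?A. of_bool (E (edge k i)) :: real) = (\<Sum>(k, i)\<in>?A. of_bool (E (edge k i)))"
    by (subst sum.reindex) (auto simp: edge_commute intro!: sum.cong)
  also have "(\<Sum>(k, i)\<in>?A. of_bool (E (edge k i)) :: real) = (\<Sum>e\<in>?A. of_bool (E e))"
    by (intro sum.cong refl) (auto simp: node_pairs_def edge_def)
  finally show ?thesis by simp
qed

section \<open>Degrees and common neighbours in a random graph\<close>

text \<open>The law of the indicators before they are arranged in a matrix; independence of the
  coordinates is visible only here.\<close>

definition edge_pmf :: "nat \<Rightarrow> (nat \<times> nat \<Rightarrow> real) \<Rightarrow> (nat \<times> nat \<Rightarrow> bool) pmf" where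
  "edge_pmf N q = Pi_pmf (node_pairs N) False (\<lambda>e. bernoulli_pmf (q e))"

lemma graph_pmf_edge: "graph_pmf N q = map_pmf (adj_mat N) (edge_pmf N q)"
  by (simp add: graph_pmf_def edge_pmf_def)

lemma finite_set_edge_pmf: "finite (set_pmf (edge_pmf N q))"
  unfolding edge_pmf_def by (rule finite_set_Pi_pmf[OF finite_node_pairs])

lemma integrable_edge_pmf [simp]:
  "integrable (measure_pmf (edge_pmf N q)) (f :: _ \<Rightarrow> real)"
  by (rule integrable_measure_pmf_finite[OF finite_set_edge_pmf])

lemma expectation_edge:
  fixes g :: "bool \<Rightarrow> real"
  assumes "e \<in> node_pairs N" "0 \<le> q e" "q e \<le> 1"
  shows "measure_pmf.expectation (edge_pmf N q) (\<lambda>E. g (E e)) = q e * g True + (1 - q e) * g False"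
proof -
  have "measure_pmf.expectation (edge_pmf N q) (\<lambda>E. g (E e)) =
        measure_pmf.expectation (map_pmf (\<lambda>E. E e) (edge_pmf N q)) g"
    by simp
  also have "map_pmf (\<lambda>E. E e) (edge_pmf N q) = bernoulli_pmf (q e)"
    unfolding edge_pmf_def using assms finite_node_pairs by (simp add: Pi_pmf_component)
  finally show ?thesis using assms by simp
qed

text \<open>Each Bernoulli factor satisfies
  \<open>1 + q (exp l - 1) \<le> exp (q (exp l - 1))\<close>, so the count is dominated by a Poisson
  variable of the same mean. Both signs of \<open>l\<close> are allowed, which serves both
  tails.\<close>

lemma mgf_edges:
  assumes "B \<subseteq> node_pairs N" "\<And>e. e \<in> B \<Longrightarrow> 0 \<le> q e \<and> q e \<le> 1"
  shows "measure_pmf.expectation (edge_pmf N q) (\<lambda>E. exp (l * (\<Sum>e\<in>B. of_bool (E e))))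
         \<le> exp ((\<Sum>e\<in>B. q e) * (exp l - 1))"
proof -
  have fin: "finite B" using assms(1) finite_node_pairs finite_subset by blast
  have "measure_pmf.expectation (edge_pmf N q) (\<lambda>E. exp (l * (\<Sum>e\<in>B. of_bool (E e)))) =
        measure_pmf.expectation (edge_pmf N q) (\<lambda>E. \<Prod>e\<in>B. exp (l * of_bool (E e)))"
    by (simp only: sum_distrib_left exp_sum[OF fin])
  also have "\<dots> = (\<Prod>e\<in>B. measure_pmf.expectation (edge_pmf N q) (\<lambda>E. exp (l * of_bool (E e))))"
    unfolding edge_pmf_def using fin assms(1)
    by (intro expectation_Pi_pmf_blocks[where L = "\<lambda>e. {e}"] finite_node_pairs)
       (auto simp: disjoint_family_on_def)
  also have "\<dots> = (\<Prod>e\<in>B. 1 + q e * (exp l - 1))"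
  proof (rule prod.cong[OF refl])
    fix e assume e: "e \<in> B"
    have "measure_pmf.expectation (edge_pmf N q) (\<lambda>E. exp (l * of_bool (E e))) =
      q e * exp (l * of_bool True) + (1 - q e) * exp (l * of_bool False)"
      by (rule expectation_edge) (use e assms in auto)
    then show "measure_pmf.expectation (edge_pmf N q) (\<lambda>E. exp (l * of_bool (E e))) = 1 + q e * (exp l - 1)"
      by (simp add: algebra_simps)
  qed
  also have "\<dots> \<le> (\<Prod>e\<in>B. exp (q e * (exp l - 1)))"
  proof (rule prod_mono)
    fix e assume e: "e \<in> B"
    \<comment> \<open>Written as a convex combination, the factor is seen to be nonnegative also for
      negative \<open>l\<close>, as a comparison of products requires.\<close>
    have "0 \<le> (1 - q e) + q e * exp l" using assms(2)[OF e] by (intro add_nonneg_nonneg) auto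
    then show "0 \<le> 1 + q e * (exp l - 1) \<and> 1 + q e * (exp l - 1) \<le> exp (q e * (exp l - 1))"
      using exp_ge_add_one_self[of "q e * (exp l - 1)"] by (simp add: algebra_simps)
  qed
  also have "\<dots> = exp ((\<Sum>e\<in>B. q e) * (exp l - 1))"
    by (simp add: exp_sum[OF fin] sum_distrib_right)
  finally show ?thesis .
qed

lemma edge_image_subset:
  "k < N \<Longrightarrow> S \<subseteq> {..<N} \<Longrightarrow> edge k ` (S - {k}) \<subseteq> node_pairs N"
  by (auto intro!: edge_in_node_pairs)

lemma inj_on_edge: "inj_on (edge k) A"
  by (auto simp: inj_on_def edge_eq_iff)

lemma degree_in_eq: "degree_in k S E = (\<Sum>e\<in>edge k ` (S - {k}). of_bool (E e))"
  unfolding degree_in_def by (subst sum.reindex[OF inj_on_edge]) simp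

lemma mgf_degree_in:
  assumes "k < N" "S \<subseteq> {..<N}" "0 \<le> p" "p \<le> 1"
    and "\<And>i. i \<in> S - {k} \<Longrightarrow> q (edge k i) = p"
  shows "measure_pmf.expectation (edge_pmf N q) (\<lambda>E. exp (l * degree_in k S E))
         \<le> exp (real (card (S - {k})) * p * (exp l - 1))"
proof -
  have "(\<Sum>e\<in>edge k ` (S - {k}). q e) = real (card (S - {k})) * p"
    by (subst sum.reindex[OF inj_on_edge]) (simp add: assms(5))
  moreover have "0 \<le> q e \<and> q e \<le> 1" if "e \<in> edge k ` (S - {k})" for e
    using that assms by (auto simp del: insert_Diff_single Diff_iff)
  ultimately show ?thesis
    using mgf_edges[OF edge_image_subset[OF assms(1,2)], of q l] by (simp add: degree_in_eq)
qed

lemma expectation_two_edges: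
  assumes "e \<in> node_pairs N" "e' \<in> node_pairs N" "e \<noteq> e'"
    and "0 \<le> q e" "q e \<le> 1" "0 \<le> q e'" "q e' \<le> 1"
  shows "measure_pmf.expectation (edge_pmf N q) (\<lambda>E. of_bool (E e) * of_bool (E e')) = q e * q e'"
proof -
  have 1: "measure_pmf.expectation (edge_pmf N q) (\<lambda>E. of_bool (E e)) = q e"
    using expectation_edge[of e N q "\<lambda>b. of_bool b"] assms by simp
  have 2: "measure_pmf.expectation (edge_pmf N q) (\<lambda>E. of_bool (E e')) = q e'"
    using expectation_edge[of e' N q "\<lambda>b. of_bool b"] assms by simp
  have "measure_pmf.expectation (edge_pmf N q) (\<lambda>E. of_bool (E e) * of_bool (E e') :: real) =
     measure_pmf.expectation (edge_pmf N q) (\<lambda>E. of_bool (E e)) *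
     measure_pmf.expectation (edge_pmf N q) (\<lambda>E. of_bool (E e'))"
    unfolding edge_pmf_def
    by (rule expectation_Pi_pmf_indep[OF finite_node_pairs, where L = "{e}" and L' = "{e'}"])
       (use assms in auto)
  then show ?thesis unfolding 1 2 .
qed

text \<open>For a fixed pair \<open>i\<close>, \<open>j\<close> the sets
  \<open>{edge i k, edge j k}\<close> are disjoint for different \<open>k\<close>. The codegree is
  therefore a sum of independent indicators, each of mean \<open>p^2\<close>.\<close>

lemma mgf_codegree:
  assumes "i < N" "j < N" "i \<noteq> j" "0 \<le> p" "p \<le> 1"
  shows "measure_pmf.expectation (edge_pmf N (\<lambda>_. p)) (\<lambda>E. exp (l * codegree N i j E))
         \<le> exp (real (N - 2) * p\<^sup>2 * (exp l - 1))"
proof -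
  let ?M = "edge_pmf N (\<lambda>_. p)" and ?K = "{..<N} - {i, j}"
  let ?b = "\<lambda>k E. of_bool (E (edge i k)) * of_bool (E (edge j k)) :: real"
  have fin: "finite ?K" by simp
  have card: "card ?K = N - 2" using assms by (subst card_Diff_subset) auto
  have "measure_pmf.expectation ?M (\<lambda>E. exp (l * codegree N i j E)) =
        measure_pmf.expectation ?M (\<lambda>E. \<Prod>k\<in>?K. exp (l * ?b k E))"
    unfolding codegree_def by (simp only: sum_distrib_left exp_sum[OF fin])
  also have "\<dots> = (\<Prod>k\<in>?K. measure_pmf.expectation ?M (\<lambda>E. exp (l * ?b k E)))"
    unfolding edge_pmf_def
    using assms
    by (intro expectation_Pi_pmf_blocks[where L = "\<lambda>k. {edge i k, edge j k}"] finite_node_pairs fin)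
       (auto simp: disjoint_family_on_def edge_eq_iff intro!: edge_in_node_pairs)
  also have "\<dots> = (\<Prod>k\<in>?K. 1 + p\<^sup>2 * (exp l - 1))"
  proof (rule prod.cong[OF refl])
    fix k assume k: "k \<in> ?K"
    \<comment> \<open>An exponential of a 0/1 variable is affine in it, so the mean of the indicator
      determines the factor.\<close>
    have *: "exp (l * ?b k E) = 1 + ?b k E * (exp l - 1)" for E :: "nat \<times> nat \<Rightarrow> bool"
      by simp
    have "measure_pmf.expectation ?M (?b k) = p * p"
      using k assms
      by (intro expectation_two_edges edge_in_node_pairs) (auto simp: edge_eq_iff)
    then show "measure_pmf.expectation ?M (\<lambda>E. exp (l * ?b k E)) = 1 + p\<^sup>2 * (exp l - 1)"
      unfolding * by (simp add: power2_eq_square)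
  qed
  also have "\<dots> \<le> (\<Prod>k\<in>?K. exp (p\<^sup>2 * (exp l - 1)))"
  proof (rule prod_mono)
    have "p\<^sup>2 \<le> 1" using assms by (simp add: power_le_one)
    then have "0 \<le> (1 - p\<^sup>2) + p\<^sup>2 * exp l" by (intro add_nonneg_nonneg) auto
    then show "0 \<le> 1 + p\<^sup>2 * (exp l - 1) \<and> 1 + p\<^sup>2 * (exp l - 1) \<le> exp (p\<^sup>2 * (exp l - 1))"
      using exp_ge_add_one_self[of "p\<^sup>2 * (exp l - 1)"] by (simp add: algebra_simps)
  qed
  also have "\<dots> = exp (real (N - 2) * p\<^sup>2 * (exp l - 1))"
    by (simp add: card exp_of_nat_mult[symmetric] mult.assoc)
  finally show ?thesis .
qed

section \<open>Moments of degrees into the community and the lower tail of their squares\<close>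

lemma expectation_degree_square:
  assumes "k < N" "S \<subseteq> {..<N}" "k \<notin> S" "0 \<le> p" "p \<le> 1"
    and "\<And>i. i \<in> S \<Longrightarrow> q (edge k i) = p"
  shows "measure_pmf.expectation (edge_pmf N q) (\<lambda>E. (degree_in k S E)\<^sup>2) =
         real (card S) * p + real (card S) * (real (card S) - 1) * p\<^sup>2"
proof -
  let ?M = "edge_pmf N q"
  have fin: "finite S" using assms(2) finite_subset by blast
  have S: "S - {k} = S" using assms(3) by auto
  \<comment> \<open>The form "diagonal correction plus constant" makes the double sum collapse: an
    indicator is idempotent, so \<open>j = i\<close> yields \<open>p\<close> in place of
    \<open>p^2\<close>.\<close>
  have b: "measure_pmf.expectation ?M (\<lambda>E. of_bool (E (edge k i)) * of_bool (E (edge k j))) =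
    (if j = i then p - p\<^sup>2 else 0) + p\<^sup>2" if "i \<in> S" "j \<in> S" for i j
  proof (cases "i = j")
    case True
    have "measure_pmf.expectation ?M (\<lambda>E. of_bool (E (edge k i))) = p"
      using expectation_edge[of "edge k i" N q "\<lambda>b. of_bool b"] assms that
      by (auto intro!: edge_in_node_pairs)
    then show ?thesis using True by (simp flip: of_bool_conj)
  next
    case False
    have "measure_pmf.expectation ?M (\<lambda>E. of_bool (E (edge k i)) * of_bool (E (edge k j))) =
      q (edge k i) * q (edge k j)"
      using False assms that
      by (intro expectation_two_edges) (auto simp: edge_eq_iff intro!: edge_in_node_pairs)
    then show ?thesis using False assms that by (simp add: power2_eq_square)
  qed
  have "measure_pmf.expectation ?M (\<lambda>E. (degree_in k S E)\<^sup>2) =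
    measure_pmf.expectation ?M (\<lambda>E. \<Sum>i\<in>S. \<Sum>j\<in>S. of_bool (E (edge k i)) * of_bool (E (edge k j)))"
    by (simp only: degree_in_def S power2_eq_square sum_product)
  also have "\<dots> = (\<Sum>i\<in>S. \<Sum>j\<in>S. measure_pmf.expectation ?M (\<lambda>E. of_bool (E (edge k i)) * of_bool (E (edge k j))))"
    by (simp only: Bochner_Integration.integral_sum integrable_edge_pmf)
  also have "\<dots> = (\<Sum>i\<in>S. \<Sum>j\<in>S. (if j = i then p - p\<^sup>2 else 0) + p\<^sup>2)"
    by (intro sum.cong refl b)
  also have "\<dots> = (\<Sum>i\<in>S. (p - p\<^sup>2) + real (card S) * p\<^sup>2)"
    using fin by (intro sum.cong refl) (simp add: sum.distrib)
  finally show ?thesis by (simp add: algebra_simps)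
qed

text \<open>
  With \<open>a\<close> of the order of \<open>1 + E X\<close>, this reduces the fourth moment of a degree \<open>X\<close> to its
  moment generating function.
\<close>

lemma pow4_le_exp:
  fixes x a :: real
  assumes "0 \<le> x" "0 < a"
  shows "x ^ 4 \<le> 256 * a ^ 4 * exp (x / a)"
proof -
  \<comment> \<open>The fourth power of this inequality gives the constant
    \<open>4^4 = 256\<close>.\<close>
  have "x / (4 * a) \<le> exp (x / (4 * a))"
    using exp_ge_add_one_self[of "x / (4 * a)"] by linarith
  then have "(x / (4 * a)) ^ 4 \<le> exp (x / (4 * a)) ^ 4"
    using assms by (intro power_mono) auto
  also have "\<dots> = exp (x / a)"
    using assms by (simp flip: exp_of_nat_mult)
  finally show ?thesis using assms by (simp add: power_divide power_mult_distrib field_simps)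
qed

text \<open>With \<open>a\<close> equal to 1 plus the mean, the exponential moment at
  \<open>1 / a\<close> is at most \<open>exp 2\<close>, bounded by 9; hence
  \<open>2304 = 256 * 9\<close>.\<close>

lemma expectation_degree_pow4:
  assumes "k < N" "S \<subseteq> {..<N}" "k \<notin> S" "0 \<le> p" "p \<le> 1"
    and "\<And>i. i \<in> S \<Longrightarrow> q (edge k i) = p"
  shows "measure_pmf.expectation (edge_pmf N q) (\<lambda>E. (degree_in k S E) ^ 4) \<le>
         2304 * (1 + real (card S) * p) ^ 4"
proof -
  let ?M = "edge_pmf N q"
  define m where "m = real (card S) * p"
  define a where "a = 1 + m"
  have m: "0 \<le> m" using assms by (simp add: m_def)
  have a: "0 < a" "1 \<le> a" using m by (auto simp: a_def)
  have S: "S - {k} = S" using assms(3) by auto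
  have "measure_pmf.expectation ?M (\<lambda>E. (degree_in k S E) ^ 4) \<le>
    measure_pmf.expectation ?M (\<lambda>E. 256 * a ^ 4 * exp (1 / a * degree_in k S E))"
  proof (rule integral_mono)
    show "degree_in k S E ^ 4 \<le> 256 * a ^ 4 * exp (1 / a * degree_in k S E)" for E
      using pow4_le_exp[of "degree_in k S E" a] a by (simp add: degree_in_def sum_nonneg)
  qed auto
  also have "\<dots> \<le> 256 * a ^ 4 * exp (m * (exp (1 / a) - 1))"
    using mgf_degree_in[OF assms(1,2,4,5), of q "1 / a"] assms(6) a
    by (simp add: S m_def)
  also have "\<dots> \<le> 256 * a ^ 4 * exp 2"
  proof -
    have "exp (1 / a) \<le> 1 + 1 / a + (1 / a)\<^sup>2"
      by (rule exp_bound) (use a in auto)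
    also have "(1 / a)\<^sup>2 \<le> 1 / a"
      using a power_decreasing[of 1 2 "1 / a"] by simp
    finally have "m * (exp (1 / a) - 1) \<le> m * (2 / a)"
      using m by (intro mult_left_mono) auto
    also have "\<dots> \<le> 2" using a m by (simp add: a_def field_simps)
    finally show ?thesis using a by (intro mult_left_mono) auto
  qed
  also have "\<dots> \<le> 256 * a ^ 4 * 9"
  proof -
    have "exp (2::real) = exp 1 * exp 1" by (simp flip: exp_add)
    also have "\<dots> \<le> 3 * 3" by (intro mult_mono exp_le) auto
    finally show ?thesis using a by (intro mult_left_mono) auto
  qed
  finally show ?thesis by (simp add: a_def m_def)
qed

text \<open>Different outside nodes use disjoint edges into \<open>S\<close>, so their degrees are
  independent. For a lower tail \<open>exp (- x) \<le> 1 - x + x^2 / 2\<close> suffices with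
  \<open>x\<close> a multiple of the squared degree, and this involves only its second and fourth
  moments; \<open>V\<close> bounds the latter.\<close>

lemma degree_squares_lower_tail:
  assumes "S \<subseteq> {..<N}" "0 \<le> p" "p \<le> 1" "0 \<le> s"
    and q: "\<And>k i. k \<in> {..<N} - S \<Longrightarrow> i \<in> S \<Longrightarrow> q (edge k i) = p"
    and n: "n = real (card S)" "n < real N" and V: "V = 2304 * (1 + n * p) ^ 4"
  shows "measure_pmf.prob (edge_pmf N q)
           {E. (\<Sum>k\<in>{..<N} - S. (degree_in k S E)\<^sup>2) \<le> (real N - n) * (n * p + n * (n - 1) * p\<^sup>2) - s}
         \<le> exp (- (s\<^sup>2 / (2 * real N * V)))"
proof -
  let ?M = "edge_pmf N q" and ?K = "{..<N} - S"
  define \<mu> where "\<mu> = n * p + n * (n - 1) * p\<^sup>2"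
  \<comment> \<open>The minimiser of \<open>- l * s + N * l^2 * V / 2\<close>, the exponent left
    once the number \<open>N - n\<close> of outside nodes is bounded by \<open>N\<close>.\<close>
  define l where "l = s / (real N * V)"
  have n0: "0 \<le> n" using n by simp
  have N: "0 < real N" using n n0 by linarith
  have Vpos: "0 < V"
    unfolding V using assms n0 by (intro mult_pos_pos zero_less_power add_pos_nonneg) auto
  have l: "0 \<le> l" using assms N Vpos by (simp add: l_def)
  have fin: "finite ?K" by simp
  have finS: "finite S" using assms(1) finite_subset by blast
  have card: "real (card ?K) = real N - n"
    using assms(1) n finS card_mono[of "{..<N}" S] by (simp add: card_Diff_subset of_nat_diff)
  let ?X = "\<lambda>E. \<Sum>k\<in>?K. (degree_in k S E)\<^sup>2"
  have one: "measure_pmf.expectation ?M (\<lambda>E. exp (- l * (degree_in k S E)\<^sup>2)) \<le> exp (- l * \<mu> + l\<^sup>2 / 2 * V)"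
    if k: "k \<in> ?K" for k
  proof -
    have "measure_pmf.expectation ?M (\<lambda>E. exp (- l * (degree_in k S E)\<^sup>2)) \<le>
      measure_pmf.expectation ?M (\<lambda>E. 1 - l * (degree_in k S E)\<^sup>2 + l\<^sup>2 / 2 * (degree_in k S E) ^ 4)"
    proof (rule integral_mono)
      show "exp (- l * (degree_in k S E)\<^sup>2) \<le> 1 - l * (degree_in k S E)\<^sup>2 + l\<^sup>2 / 2 * (degree_in k S E) ^ 4" for E
        using exp_minus_le_quadratic[of "l * (degree_in k S E)\<^sup>2"] l
        by (simp add: power_mult_distrib power_mult[symmetric])
    qed auto
    also have "\<dots> = 1 - l * \<mu> + l\<^sup>2 / 2 * measure_pmf.expectation ?M (\<lambda>E. (degree_in k S E) ^ 4)"
      using expectation_degree_square[of k N S p q] k assms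
      by (simp add: \<mu>_def n)
    also have "\<dots> \<le> 1 - l * \<mu> + l\<^sup>2 / 2 * V"
    proof -
      have "measure_pmf.expectation ?M (\<lambda>E. (degree_in k S E) ^ 4) \<le> V"
        unfolding V n by (rule expectation_degree_pow4) (use k assms in auto)
      from mult_left_mono[OF this, of "l\<^sup>2 / 2"] show ?thesis by simp
    qed
    also have "\<dots> \<le> exp (- l * \<mu> + l\<^sup>2 / 2 * V)"
      using exp_ge_add_one_self[of "- l * \<mu> + l\<^sup>2 / 2 * V"] by linarith
    finally show ?thesis .
  qed
  have "measure_pmf.expectation ?M (\<lambda>E. exp (l * - ?X E)) =
        measure_pmf.expectation ?M (\<lambda>E. \<Prod>k\<in>?K. exp (- l * (degree_in k S E)\<^sup>2))"
    by (simp add: sum_distrib_left exp_sum[OF fin] flip: sum_negf)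
  also have "\<dots> = (\<Prod>k\<in>?K. measure_pmf.expectation ?M (\<lambda>E. exp (- l * (degree_in k S E)\<^sup>2)))"
    unfolding edge_pmf_def
  proof (intro expectation_Pi_pmf_blocks[where L = "\<lambda>k. edge k ` S"] finite_node_pairs fin)
    show "edge k ` S \<subseteq> node_pairs N" if "k \<in> ?K" for k
      using edge_image_subset[of k N S] that assms(1) by auto
    show "disjoint_family_on (\<lambda>k. edge k ` S) ?K"
      by (auto simp: disjoint_family_on_def edge_eq_iff)
    show "exp (- l * (degree_in k S E)\<^sup>2) = exp (- l * (degree_in k S E')\<^sup>2)"
      if "\<And>e. e \<in> edge k ` S \<Longrightarrow> E e = E' e" for k E E'
    proof -
      have "degree_in k S E = degree_in k S E'"
        unfolding degree_in_def using that by (intro sum.cong refl) auto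
      then show ?thesis by simp
    qed
  qed
  also have "\<dots> \<le> (\<Prod>k\<in>?K. exp (- l * \<mu> + l\<^sup>2 / 2 * V))"
    by (intro prod_mono conjI one Bochner_Integration.integral_nonneg) auto
  also have "\<dots> = exp ((real N - n) * (- l * \<mu> + l\<^sup>2 / 2 * V))"
    by (simp only: prod_constant card flip: exp_of_nat_mult)
  finally have mgf: "measure_pmf.expectation ?M (\<lambda>E. exp (l * - ?X E)) \<le> exp ((real N - n) * (- l * \<mu> + l\<^sup>2 / 2 * V))" .
  have "measure_pmf.prob ?M {E. ?X E \<le> (real N - n) * \<mu> - s} =
        measure_pmf.prob ?M {E. s - (real N - n) * \<mu> \<le> - ?X E}"
    by (rule arg_cong[where f = "measure_pmf.prob ?M"]) auto
  also have "\<dots> \<le> exp (- l * (s - (real N - n) * \<mu>)) * measure_pmf.expectation ?M (\<lambda>E. exp (l * - ?X E))"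
    by (rule chernoff_ge[OF finite_set_edge_pmf l])
  also have "\<dots> \<le> exp (- l * (s - (real N - n) * \<mu>)) * exp ((real N - n) * (- l * \<mu> + l\<^sup>2 / 2 * V))"
    by (intro mult_left_mono mgf) auto
  also have "\<dots> = exp (- l * s + (real N - n) * (l\<^sup>2 / 2 * V))"
    by (simp add: algebra_simps flip: exp_add)
  also have "\<dots> \<le> exp (- l * s + real N * (l\<^sup>2 / 2 * V))"
    using n0 Vpos by (simp add: mult_right_mono)
  also have "- l * s + real N * (l\<^sup>2 / 2 * V) = - (s\<^sup>2 / (2 * real N * V))"
    unfolding l_def using N Vpos by (simp add: field_simps power2_eq_square)
  finally show ?thesis by (simp add: \<mu>_def)
qed

section \<open>Level and power for a fixed number of nodes\<close>

lemma p_value_eq: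
  "p_value N n x p = measure_pmf.prob (edge_pmf N (\<lambda>_. p)) {E. x \<le> SDP n (adj_mat N E ^\<^sub>m 2)}"
  unfolding p_value_def erdos_renyi_def graph_pmf_edge by (simp add: vimage_def)

text \<open>Off \<open>N\<close> degree events and at most \<open>N^2\<close> codegree events,
  \<open>SDP_adj_le\<close> keeps the statistic below \<open>x\<close>. The thresholds depend on
  \<open>p'\<close> alone, so one bound covers every calibration parameter up to
  \<open>p'\<close>.\<close>

lemma p_value_le:
  assumes n: "0 < n" "n \<le> N" and p: "0 \<le> p" "p \<le> p'" "p \<le> 1" "0 < p'"
    and s: "0 \<le> s" "s \<le> real N * p'" and r: "0 \<le> r" "r \<le> real N * p'\<^sup>2"
    and x: "real N * p' + s + (real n - 1) * (real N * p'\<^sup>2 + r) < x"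
  shows "p_value N n x p \<le>
    real N * exp (- (s\<^sup>2 / (2 * (real N * p'))) * (1 - s / (real N * p'))) +
    (real N)\<^sup>2 * exp (- (r\<^sup>2 / (2 * (real N * p'\<^sup>2))) * (1 - r / (real N * p'\<^sup>2)))"
    (is "_ \<le> real N * ?a + (real N)\<^sup>2 * ?b")
proof -
  let ?M = "edge_pmf N (\<lambda>_. p)"
  define A where "A i = {E. real N * p' + s \<le> degree_in i {..<N} E}" for i
  define B where "B z = {E. real N * p'\<^sup>2 + r \<le> codegree N (fst z) (snd z) E}" for z
  let ?J = "{..<N} \<times> {..<N} - Id"
  have N: "0 < real N" using n by simp
  have "{E. x \<le> SDP n (adj_mat N E ^\<^sub>m 2)} \<subseteq> (\<Union>i<N. A i) \<union> (\<Union>z\<in>?J. B z)"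
  proof (rule subsetI, rule ccontr)
    fix E assume "E \<in> {E. x \<le> SDP n (adj_mat N E ^\<^sub>m 2)}"
      and notin: "E \<notin> (\<Union>i<N. A i) \<union> (\<Union>z\<in>?J. B z)"
    then have E: "x \<le> SDP n (adj_mat N E ^\<^sub>m 2)" by simp
    have "SDP n (adj_mat N E ^\<^sub>m 2) \<le> (real N * p' + s) + (real n - 1) * (real N * p'\<^sup>2 + r)"
    proof (rule SDP_adj_le[OF n])
      show "degree_in i {..<N} E \<le> real N * p' + s" if "i < N" for i
      proof -
        have "E \<notin> A i" using notin that by blast
        then show ?thesis by (simp add: A_def)
      qed
      show "codegree N i j E \<le> real N * p'\<^sup>2 + r" if "i < N" "j < N" "i \<noteq> j" for i j
      proof -
        have "(i, j) \<in> ?J" using that by auto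
        then have "E \<notin> B (i, j)" using notin by blast
        then show ?thesis by (simp add: B_def)
      qed
    qed (use r in auto)
    then show False using E x by linarith
  qed
  then have "p_value N n x p \<le> measure_pmf.prob ?M ((\<Union>i<N. A i) \<union> (\<Union>z\<in>?J. B z))"
    unfolding p_value_eq by (intro measure_pmf.finite_measure_mono) auto
  also have "\<dots> \<le> measure_pmf.prob ?M (\<Union>i<N. A i) + measure_pmf.prob ?M (\<Union>z\<in>?J. B z)"
    by (intro measure_Un_le) auto
  also have "\<dots> \<le> (\<Sum>i<N. measure_pmf.prob ?M (A i)) + (\<Sum>z\<in>?J. measure_pmf.prob ?M (B z))"
    by (intro add_mono measure_pmf.finite_measure_subadditive_finite) auto
  also have "(\<Sum>i<N. measure_pmf.prob ?M (A i)) \<le> (\<Sum>i<N. ?a)"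
  proof (rule sum_mono)
    fix i assume i: "i \<in> {..<N}"
    have card: "card ({..<N} - {i}) = N - 1" using i by simp
    let ?m = "real (card ({..<N} - {i})) * p"
    have m: "?m \<le> real N * p'" unfolding card using p by (intro mult_mono) auto
    have "measure_pmf.prob ?M (A i) \<le> measure_pmf.prob ?M {E. ?m + s \<le> degree_in i {..<N} E}"
      by (intro measure_pmf.finite_measure_mono) (use m in \<open>auto simp: A_def B_def\<close>)
    also have "\<dots> \<le> ?a"
      using i p N s m
      by (intro poisson_upper_tail finite_set_edge_pmf mgf_degree_in) auto
    finally show "measure_pmf.prob ?M (A i) \<le> ?a" .
  qed
  also have "(\<Sum>z\<in>?J. measure_pmf.prob ?M (B z)) \<le> (\<Sum>z\<in>?J. ?b)"
  proof (rule sum_mono)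
    fix z assume "z \<in> ?J"
    then obtain i j where z: "z = (i, j)" and ij: "i < N" "j < N" "(i, j) \<notin> Id" by auto
    let ?m = "real (N - 2) * p\<^sup>2"
    have m: "?m \<le> real N * p'\<^sup>2" using p by (intro mult_mono power_mono) auto
    have "measure_pmf.prob ?M (B (i, j))
        \<le> measure_pmf.prob ?M {E. ?m + r \<le> codegree N i j E}"
      by (intro measure_pmf.finite_measure_mono) (use m in \<open>auto simp: A_def B_def\<close>)
    also have "\<dots> \<le> ?b"
      using ij p N r m
      by (intro poisson_upper_tail finite_set_edge_pmf mgf_codegree) auto
    finally show "measure_pmf.prob ?M (B z) \<le> ?b" unfolding z .
  qed
  also have "(\<Sum>z\<in>?J. ?b) \<le> (\<Sum>z\<in>{..<N} \<times> {..<N}. ?b)"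
    by (intro sum_mono2) auto
  also have "\<dots> = (real N)\<^sup>2 * ?b"
    by (simp add: card_cartesian_product power2_eq_square)
  finally show ?thesis by simp
qed

section \<open>The statistic under the alternative\<close>

definition planted_prob :: "nat set \<Rightarrow> real \<Rightarrow> real \<Rightarrow> nat \<times> nat \<Rightarrow> real" where
  "planted_prob S p0 p1 = (\<lambda>(i, j). if i \<in> S \<and> j \<in> S then p1 else p0)"

lemma prob_planted:
  "measure_pmf.prob (planted N S p0 p1) {W. P W} =
   measure_pmf.prob (edge_pmf N (planted_prob S p0 p1)) {E. P (adj_mat N E)}"
  unfolding planted_def graph_pmf_edge planted_prob_def by (simp add: vimage_def)

lemma prob_erdos_renyi:
  "measure_pmf.prob (erdos_renyi N p) {W. P W} =
   measure_pmf.prob (edge_pmf N (\<lambda>_. p)) {E. P (adj_mat N E)}"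
  unfolding erdos_renyi_def graph_pmf_edge by (simp add: vimage_def)

lemma card_inner_pairs:
  assumes "S \<subseteq> {..<N}"
  shows "2 * real (card (node_pairs N \<inter> S \<times> S)) = real (card S) * (real (card S) - 1)"
proof -
  have fin: "finite S" using assms finite_subset by blast
  \<comment> \<open>The count is the handshake identity for the complete graph.\<close>
  have "2 * real (card (node_pairs N \<inter> S \<times> S)) = (\<Sum>k\<in>S. degree_in k S (\<lambda>_. True))"
    unfolding sum_degree_in[OF assms] by simp
  also have "\<dots> = (\<Sum>k\<in>S. real (card S) - 1)"
  proof (rule sum.cong[OF refl])
    fix k assume k: "k \<in> S"
    then have "0 < card S" using fin card_gt_0_iff by blast
    then show "degree_in k S (\<lambda>_. True) = real (card S) - 1"
      unfolding degree_in_def using k fin by (simp add: card_Diff_singleton of_nat_diff)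
  qed
  finally show ?thesis by simp
qed

text \<open>The first two terms of \<open>L\<close> come from the degrees of outside nodes into
  \<open>S\<close> and their fluctuation, the last two from the edges inside \<open>S\<close>. Each
  part fails with probability at most \<open>exp (- w^2)\<close>.\<close>

lemma planted_SDP_lower:
  assumes S: "S \<subseteq> {..<N}" "card S = n" and n: "2 \<le> n" "n < N"
    and p: "0 \<le> p0" "p0 \<le> 1" "0 < p1" "p1 \<le> 1" and w: "0 \<le> w"
    and L: "L = (real N - real n) * (p0 + (real n - 1) * p0\<^sup>2)
              - 70 * w * sqrt (real N) * (1 + real n * p0)\<^sup>2 / real n
              + (real n - 1)\<^sup>2 * p1\<^sup>2 - 4 * w * real n"
  shows "measure_pmf.prob (planted N S p0 p1) {W. SDP n (W ^\<^sub>m 2) < L} \<le> 2 * exp (- (w\<^sup>2))"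
proof -
  let ?q = "planted_prob S p0 p1"
  let ?M = "edge_pmf N ?q"
  define m where "m = real n"
  have m: "2 \<le> m" "m < real N" using n by (auto simp: m_def)
  define V where "V = 2304 * (1 + m * p0) ^ 4"
  \<comment> \<open>Since \<open>70^2 = 4900\<close> exceeds \<open>2 * 2304\<close>, the exponent
    \<open>s^2 / (2 N V)\<close> is at least \<open>w^2\<close>.\<close>
  define s where "s = 70 * w * sqrt (real N) * (1 + m * p0)\<^sup>2"
  define \<mu> where "\<mu> = m * (m - 1) / 2 * p1"
  define B where "B = node_pairs N \<inter> S \<times> S"
  let ?X = "\<lambda>E. \<Sum>k\<in>{..<N} - S. (degree_in k S E)\<^sup>2"
  let ?Y = "\<lambda>E. \<Sum>e\<in>B. of_bool (E e) :: real"
  let ?T = "(real N - m) * (m * p0 + m * (m - 1) * p0\<^sup>2) - s"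
  have a: "0 < 1 + m * p0" using p m by (simp add: add_pos_nonneg)
  have X: "measure_pmf.prob ?M {E. ?X E \<le> ?T} \<le> exp (- (w\<^sup>2))"
  proof -
    have "measure_pmf.prob ?M {E. ?X E \<le> ?T} \<le> exp (- (s\<^sup>2 / (2 * real N * V)))"
    proof (rule degree_squares_lower_tail)
      show "0 \<le> s" unfolding s_def using w by simp
      show "?q (edge k i) = p0" if "k \<in> {..<N} - S" "i \<in> S" for k i
        using that by (auto simp: planted_prob_def edge_def min_def max_def)
    qed (use S p m in \<open>auto simp: m_def V_def\<close>)
    also have "s\<^sup>2 / (2 * real N * V) = 4900 / 4608 * w\<^sup>2"
    proof -
      have "s\<^sup>2 = 4900 * w\<^sup>2 * real N * (1 + m * p0) ^ 4"
        unfolding s_def by (simp add: power_mult_distrib flip: power_mult)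
      then show ?thesis unfolding V_def using a m by (simp add: field_simps)
    qed
    also have "exp (- (4900 / 4608 * w\<^sup>2)) \<le> exp (- (w\<^sup>2))" by simp
    finally show ?thesis .
  qed
  \<comment> \<open>The mean satisfies \<open>2 * \<mu> \<le> m^2\<close>, so a deviation of
    \<open>m * w\<close> costs an exponent of at least \<open>w^2\<close>.\<close>
  have Y: "measure_pmf.prob ?M {E. ?Y E \<le> \<mu> - m * w} \<le> exp (- (w\<^sup>2))"
  proof -
    have q: "?q e = p1" if "e \<in> B" for e using that by (auto simp: B_def planted_prob_def)
    have "(\<Sum>e\<in>B. ?q e) = real (card B) * p1" using q by simp
    then have qs: "(\<Sum>e\<in>B. ?q e) = \<mu>"
      using card_inner_pairs[OF S(1)] S(2) by (simp add: B_def \<mu>_def m_def)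
    have \<mu>: "0 < \<mu>" unfolding \<mu>_def using m p by (intro mult_pos_pos divide_pos_pos) auto
    have "measure_pmf.prob ?M {E. ?Y E \<le> \<mu> - m * w} \<le> exp (- ((m * w)\<^sup>2 / (2 * \<mu>)))"
    proof (rule poisson_lower_tail[OF finite_set_edge_pmf _ \<mu>])
      show "measure_pmf.expectation ?M (\<lambda>E. exp (l * ?Y E)) \<le> exp (\<mu> * (exp l - 1))" for l
        using mgf_edges[of B N ?q l] q p unfolding qs by (auto simp: B_def)
    qed (use m w in auto)
    also have "\<dots> \<le> exp (- (w\<^sup>2))"
    proof -
      have "2 * \<mu> = m * (m - 1) * p1" by (simp add: \<mu>_def)
      also have "\<dots> \<le> m * m * 1"
        using m p by (intro mult_mono) auto
      finally have "w\<^sup>2 * (2 * \<mu>) \<le> w\<^sup>2 * (m * m)" by (intro mult_left_mono) auto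
      then have "w\<^sup>2 \<le> (m * w)\<^sup>2 / (2 * \<mu>)"
        using \<mu> by (simp add: field_simps power2_eq_square)
      then show ?thesis by simp
    qed
    finally show ?thesis .
  qed
  have "{E. SDP n (adj_mat N E ^\<^sub>m 2) < L} \<subseteq> {E. ?X E \<le> ?T} \<union> {E. ?Y E \<le> \<mu> - m * w}"
  proof (rule subsetI, rule ccontr)
    fix E assume "E \<in> {E. SDP n (adj_mat N E ^\<^sub>m 2) < L}"
      and "E \<notin> {E. ?X E \<le> ?T} \<union> {E. ?Y E \<le> \<mu> - m * w}"
    then have E: "SDP n (adj_mat N E ^\<^sub>m 2) < L" "?T < ?X E" "\<mu> - m * w < ?Y E"
      by (simp_all only: Un_iff mem_Collect_eq de_Morgan_disj not_le)
    \<comment> \<open>The average degree inside \<open>S\<close>, with mean \<open>c\<close>; its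
      square is what the inner edges contribute to the normalised statistic.\<close>
    define y where "y = 2 * ?Y E / m"
    define c where "c = (m - 1) * p1"
    have y0: "0 \<le> y" using m by (simp add: y_def sum_nonneg)
    have c: "0 \<le> c" "c \<le> m"
      using m p mult_mono[of "m - 1" m p1 1] by (auto simp: c_def)
    have yc: "c - 2 * w \<le> y"
      using E(3) m unfolding y_def c_def \<mu>_def by (simp add: field_simps)
    \<comment> \<open>Squaring \<open>c - 2 * w \<le> y\<close> is legitimate only when the left
      side is nonnegative; otherwise \<open>c^2 - 4 * w * m\<close> is not positive and the claim is
      trivial.\<close>
    have y2: "c\<^sup>2 - 4 * w * m \<le> y\<^sup>2"
    proof (cases "c \<le> 2 * w")
      case True
      then have "c * c \<le> 2 * w * m" using c w by (intro mult_mono) auto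
      moreover have "0 \<le> w * m" using w m by simp
      moreover have "0 \<le> y\<^sup>2" by simp
      ultimately show ?thesis unfolding power2_eq_square[of c] by linarith
    next
      case False
      then have "(c - 2 * w)\<^sup>2 \<le> y\<^sup>2" using yc by (intro power_mono) auto
      moreover have "c\<^sup>2 - 4 * w * m \<le> (c - 2 * w)\<^sup>2"
      proof -
        have "w * c \<le> w * m" using c w by (intro mult_left_mono)
        moreover have "0 \<le> w\<^sup>2" by simp
        moreover have "(c - 2 * w)\<^sup>2 = c\<^sup>2 - 4 * (w * c) + 4 * w\<^sup>2"
          by (simp add: power2_eq_square algebra_simps)
        ultimately show ?thesis by linarith
      qed
      ultimately show ?thesis by simp
    qed
    have "L = ?T / m + (c\<^sup>2 - 4 * w * m)"
    proof -
      have "?T / m = (real N - m) * (p0 + (m - 1) * p0\<^sup>2) - s / m"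
        using m by (simp add: field_simps)
      then show ?thesis unfolding L s_def c_def m_def[symmetric]
        by (simp add: power_mult_distrib)
    qed
    also have "\<dots> \<le> ?X E / m + y\<^sup>2"
      using E(2) y2 m by (intro add_mono divide_right_mono) auto
    also have "y\<^sup>2 = (\<Sum>k\<in>S. degree_in k S E)\<^sup>2 / m / m"
      unfolding sum_degree_in[OF S(1)] y_def B_def using m by (simp add: power_divide power2_eq_square)
    also have "?X E / m + \<dots> = (?X E + (\<Sum>k\<in>S. degree_in k S E)\<^sup>2 / m) / m"
      by (simp add: add_divide_distrib)
    also have "\<dots> \<le> (\<Sum>k<N. (degree_in k S E)\<^sup>2) / m"
      using sum_squares_split[OF S, of "\<lambda>k. degree_in k S E"] m n
      by (intro divide_right_mono) (auto simp: m_def)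
    also have "\<dots> \<le> SDP n (adj_mat N E ^\<^sub>m 2)"
      using SDP_adj_ge[OF S] n by (simp add: m_def)
    finally show False using E(1) by simp
  qed
  then have "measure_pmf.prob ?M {E. SDP n (adj_mat N E ^\<^sub>m 2) < L} \<le>
      measure_pmf.prob ?M ({E. ?X E \<le> ?T} \<union> {E. ?Y E \<le> \<mu> - m * w})"
    by (intro measure_pmf.finite_measure_mono) auto
  also have "\<dots> \<le> measure_pmf.prob ?M {E. ?X E \<le> ?T} + measure_pmf.prob ?M {E. ?Y E \<le> \<mu> - m * w}"
    by (intro measure_Un_le) auto
  also have "\<dots> \<le> 2 * exp (- (w\<^sup>2))" using X Y by simp
  finally show ?thesis by (simp add: prob_planted)
qed

section \<open>Concentration of the estimated connection probability\<close>

lemma p_hat_adj: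
  "p_hat N (adj_mat N E) = (\<Sum>e\<in>node_pairs N. of_bool (E e)) * (2 / (real N * (real N - 1)))"
proof -
  have "(\<Sum>(i, j)\<in>node_pairs N. adj_mat N E $$ (i, j)) = (\<Sum>e\<in>node_pairs N. of_bool (E e))"
    by (intro sum.cong refl) (auto simp: node_pairs_def adj_mat_def)
  then show ?thesis by (simp add: p_hat_def)
qed

lemma p_hat_nonneg: "1 \<le> N \<Longrightarrow> 0 \<le> p_hat N (adj_mat N E)"
  unfolding p_hat_adj by (intro mult_nonneg_nonneg sum_nonneg) auto

lemma real_card_node_pairs: "1 \<le> N \<Longrightarrow> real (card (node_pairs N)) = real N * (real N - 1) / 2"
  using card_node_pairs[of N, THEN arg_cong[where f = real]] by (simp add: of_nat_diff)

text \<open>The community adds at most \<open>n^2 / 2\<close> to the mean number of edges. As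
  \<open>n^2 \<le> N - 1\<close> and \<open>w \<ge> 1\<close>, this is at most \<open>s\<close>,
  half of the allowed excess; the other half absorbs the random fluctuation.\<close>

lemma planted_p_hat_upper:
  assumes S: "S \<subseteq> {..<N}" "card S = n" and N: "2 \<le> N" "(real n)\<^sup>2 \<le> real N - 1"
    and p: "0 \<le> p0" "p0 \<le> 1" "0 \<le> p1" "p1 \<le> 1" and w: "1 \<le> w" "w \<le> real N / 2"
  shows "measure_pmf.prob (planted N S p0 p1) {W. p0 + 2 * w / real N < p_hat N W} \<le> exp (- (w\<^sup>2 / 32))"
proof -
  let ?q = "planted_prob S p0 p1" and ?A = "node_pairs N"
  let ?M = "edge_pmf N ?q"
  let ?X = "\<lambda>E. \<Sum>e\<in>?A. of_bool (E e) :: real"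
  define s where "s = w * (real N - 1) / 2"
  \<comment> \<open>A bound on the mean that ignores \<open>p0\<close>. It still gives
    \<open>s^2 / (2 * \<nu>) \<ge> w^2 / 16\<close> because \<open>N - 1 \<ge> N / 2\<close>, and
    \<open>s \<le> \<nu> / 2\<close> costs another factor 2.\<close>
  define \<nu> where "\<nu> = (real N)\<^sup>2 / 2"
  define \<mu> where "\<mu> = (\<Sum>e\<in>?A. ?q e)"
  have q: "0 \<le> ?q e" "?q e \<le> 1" "?q e \<le> p0 + of_bool (e \<in> S \<times> S)" for e
    using p by (auto simp: planted_prob_def split: prod.splits)
  have \<mu>: "0 \<le> \<mu>" unfolding \<mu>_def using q by (intro sum_nonneg)
  have "\<mu> \<le> (\<Sum>e\<in>?A. p0 + of_bool (e \<in> S \<times> S))"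
    unfolding \<mu>_def by (intro sum_mono q)
  also have "\<dots> = real (card ?A) * p0 + real (card (?A \<inter> S \<times> S))"
    by (simp add: sum.distrib finite_node_pairs)
  also have "real (card (?A \<inter> S \<times> S)) \<le> (real n)\<^sup>2 / 2"
    using card_inner_pairs[OF S(1)] S(2) by (simp add: power2_eq_square algebra_simps)
  also have "(real n)\<^sup>2 / 2 \<le> s"
  proof -
    have "1 * (real N - 1) \<le> w * (real N - 1)" using N w by (intro mult_right_mono) auto
    then show ?thesis using N(2) by (simp add: s_def)
  qed
  finally have \<mu>_le: "\<mu> \<le> real N * (real N - 1) / 2 * p0 + s"
    using real_card_node_pairs[of N] N by simp
  have s: "0 \<le> s" "s \<le> \<nu> / 2"
  proof -
    show "0 \<le> s" unfolding s_def using w N by simp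
    have "w * (real N - 1) \<le> real N / 2 * real N" using w N by (intro mult_mono) auto
    then show "s \<le> \<nu> / 2" by (simp add: s_def \<nu>_def power2_eq_square)
  qed
  have \<nu>: "0 < \<nu>" using N by (simp add: \<nu>_def)
  have \<mu>\<nu>: "\<mu> \<le> \<nu>"
  proof -
    have "\<mu> \<le> (\<Sum>e\<in>?A. 1)" unfolding \<mu>_def by (intro sum_mono q)
    also have "\<dots> = real N * (real N - 1) / 2" using real_card_node_pairs[of N] N by simp
    also have "\<dots> \<le> \<nu>" by (simp add: \<nu>_def power2_eq_square field_simps)
    finally show ?thesis .
  qed
  have "{E. p0 + 2 * w / real N < p_hat N (adj_mat N E)} \<subseteq> {E. \<mu> + s \<le> ?X E}"
  proof clarify
    fix E assume "p0 + 2 * w / real N < p_hat N (adj_mat N E)"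
    then have "(p0 + 2 * w / real N) * (real N * (real N - 1) / 2) < ?X E"
      using N by (simp add: p_hat_adj field_simps)
    moreover have "(p0 + 2 * w / real N) * (real N * (real N - 1) / 2) =
        real N * (real N - 1) / 2 * p0 + s + s"
      using N by (simp add: s_def field_simps)
    ultimately show "\<mu> + s \<le> ?X E" using \<mu>_le by linarith
  qed
  then have "measure_pmf.prob ?M {E. p0 + 2 * w / real N < p_hat N (adj_mat N E)} \<le>
      measure_pmf.prob ?M {E. \<mu> + s \<le> ?X E}"
    by (intro measure_pmf.finite_measure_mono) auto
  also have "\<dots> \<le> exp (- (s\<^sup>2 / (2 * \<nu>)) * (1 - s / \<nu>))"
    using \<mu> \<mu>\<nu> \<nu> s mgf_edges[of ?A N ?q] q unfolding \<mu>_def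
    by (intro poisson_upper_tail finite_set_edge_pmf) auto
  also have "\<dots> \<le> exp (- (w\<^sup>2 / 32))"
  proof -
    define x where "x = real N - 1"
    have "(real N / 2)\<^sup>2 \<le> x\<^sup>2" using N by (intro power_mono) (auto simp: x_def)
    then have "w\<^sup>2 * (real N / 2)\<^sup>2 \<le> w\<^sup>2 * x\<^sup>2" by (rule mult_left_mono) simp
    then have "w\<^sup>2 / 16 \<le> s\<^sup>2 / (2 * \<nu>)"
      using N unfolding s_def \<nu>_def x_def[symmetric]
      by (simp add: field_simps power_mult_distrib power_divide)
    moreover have "1 / 2 \<le> 1 - s / \<nu>" using s \<nu> by (simp add: field_simps)
    ultimately have "w\<^sup>2 / 16 * (1 / 2) \<le> s\<^sup>2 / (2 * \<nu>) * (1 - s / \<nu>)"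
      using \<nu> by (intro mult_mono) auto
    then show ?thesis by simp
  qed
  finally show ?thesis by (simp add: prob_planted)
qed

text \<open>The window has the order of \<open>w\<close> standard deviations of the estimate. This
  precision, finer than the one under the alternative, is what the change of measure in
  \<open>level_bound\<close> can afford.\<close>

lemma null_p_hat:
  assumes N: "2 \<le> N" and p: "0 < p0" "p0 \<le> 1" and w: "0 \<le> w" "2 * w \<le> real N * sqrt p0"
  shows "measure_pmf.prob (erdos_renyi N p0) {W. w * sqrt p0 / real N < \<bar>p_hat N W - p0\<bar>}
         \<le> 2 * exp (- (w\<^sup>2 / 16))"
proof -
  let ?A = "node_pairs N" and ?M = "edge_pmf N (\<lambda>_. p0)"
  let ?X = "\<lambda>E. \<Sum>e\<in>?A. of_bool (E e) :: real"
  define s where "s = w * sqrt p0 * (real N - 1) / 2"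
  define \<mu> where "\<mu> = real N * (real N - 1) / 2 * p0"
  have \<mu>: "0 < \<mu>" unfolding \<mu>_def using N p by simp
  have s: "0 \<le> s" unfolding s_def using N p w by simp
  have sum: "(\<Sum>e\<in>?A. p0) = \<mu>"
    using real_card_node_pairs[of N] N by (simp add: \<mu>_def)
  have mgf: "measure_pmf.expectation ?M (\<lambda>E. exp (l * ?X E)) \<le> exp (\<mu> * (exp l - 1))" for l
    using mgf_edges[of ?A N "\<lambda>_. p0" l] p unfolding sum by simp
  have s2: "s \<le> \<mu> / 2"
  proof -
    have "2 * w * sqrt p0 \<le> real N * sqrt p0 * sqrt p0"
      using w p by (intro mult_right_mono) auto
    then have "2 * w * sqrt p0 \<le> real N * p0" using p by (simp add: mult.assoc)
    then have "2 * w * sqrt p0 * ((real N - 1) / 4) \<le> real N * p0 * ((real N - 1) / 4)"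
      using N by (intro mult_right_mono) auto
    then show ?thesis unfolding s_def \<mu>_def by (simp add: field_simps)
  qed
  have s\<mu>: "w\<^sup>2 / 8 \<le> s\<^sup>2 / (2 * \<mu>)"
  proof -
    define x where "x = real N - 1"
    have x: "0 < x" using N by (simp add: x_def)
    have "s\<^sup>2 = w\<^sup>2 * p0 * x\<^sup>2 / 4"
      unfolding s_def x_def using p by (simp add: power_mult_distrib power_divide)
    then have "s\<^sup>2 / (2 * \<mu>) = w\<^sup>2 * x / (4 * real N)"
      unfolding \<mu>_def x_def[symmetric] using N p x by (simp add: field_simps power2_eq_square)
    then have "s\<^sup>2 / (2 * \<mu>) = w\<^sup>2 * (real N - 1) / (4 * real N)" by (simp add: x_def)
    moreover have "w\<^sup>2 * (real N / 2) \<le> w\<^sup>2 * (real N - 1)"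
      using N by (intro mult_left_mono) auto
    ultimately have "w\<^sup>2 * (real N / 2) / (4 * real N) \<le> s\<^sup>2 / (2 * \<mu>)"
      using N by (simp only:) (intro divide_right_mono, auto)
    then show ?thesis using N by simp
  qed
  have up: "measure_pmf.prob ?M {E. \<mu> + s \<le> ?X E} \<le> exp (- (w\<^sup>2 / 16))"
  proof -
    have "measure_pmf.prob ?M {E. \<mu> + s \<le> ?X E} \<le> exp (- (s\<^sup>2 / (2 * \<mu>)) * (1 - s / \<mu>))"
      using \<mu> s s2 by (intro poisson_upper_tail finite_set_edge_pmf mgf) auto
    also have "\<dots> \<le> exp (- (w\<^sup>2 / 16))"
    proof -
      have "1 / 2 \<le> 1 - s / \<mu>" using s2 \<mu> by (simp add: field_simps)
      then have "w\<^sup>2 / 8 * (1 / 2) \<le> s\<^sup>2 / (2 * \<mu>) * (1 - s / \<mu>)"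
        using s\<mu> \<mu> by (intro mult_mono) auto
      then show ?thesis by simp
    qed
    finally show ?thesis .
  qed
  have low: "measure_pmf.prob ?M {E. ?X E \<le> \<mu> - s} \<le> exp (- (w\<^sup>2 / 16))"
  proof -
    have "measure_pmf.prob ?M {E. ?X E \<le> \<mu> - s} \<le> exp (- (s\<^sup>2 / (2 * \<mu>)))"
      using \<mu> s by (intro poisson_lower_tail finite_set_edge_pmf mgf) auto
    also have "\<dots> \<le> exp (- (w\<^sup>2 / 16))"
    proof -
      have "w\<^sup>2 / 16 \<le> s\<^sup>2 / (2 * \<mu>)" using s\<mu> zero_le_power2[of w] by linarith
      then show ?thesis by simp
    qed
    finally show ?thesis .
  qed
  have "{E. w * sqrt p0 / real N < \<bar>p_hat N (adj_mat N E) - p0\<bar>} \<subseteq> {E. \<mu> + s \<le> ?X E} \<union> {E. ?X E \<le> \<mu> - s}"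
  proof clarify
    fix E assume E: "w * sqrt p0 / real N < \<bar>p_hat N (adj_mat N E) - p0\<bar>" "\<not> ?X E \<le> \<mu> - s"
    define c where "c = real N * (real N - 1) / 2"
    have c: "0 < c" using N by (simp add: c_def)
    have X: "?X E = c * p_hat N (adj_mat N E)"
      unfolding p_hat_adj c_def using N by simp
    have sc: "s = c * (w * sqrt p0 / real N)" "\<mu> = c * p0"
      using N by (auto simp: s_def c_def \<mu>_def)
    from E(2) have "c * (p0 - w * sqrt p0 / real N) < c * p_hat N (adj_mat N E)"
      unfolding X sc by (simp add: algebra_simps)
    then have "p0 - w * sqrt p0 / real N < p_hat N (adj_mat N E)"
      using c by simp
    with E(1) have "p0 + w * sqrt p0 / real N \<le> p_hat N (adj_mat N E)" by linarith
    then have "c * (p0 + w * sqrt p0 / real N) \<le> ?X E"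
      unfolding X using c by simp
    then show "\<mu> + s \<le> ?X E"
      unfolding sc by (simp add: algebra_simps)
  qed
  then have "measure_pmf.prob ?M {E. w * sqrt p0 / real N < \<bar>p_hat N (adj_mat N E) - p0\<bar>} \<le>
     measure_pmf.prob ?M ({E. \<mu> + s \<le> ?X E} \<union> {E. ?X E \<le> \<mu> - s})"
    by (intro measure_pmf.finite_measure_mono) auto
  also have "\<dots> \<le> measure_pmf.prob ?M {E. \<mu> + s \<le> ?X E} + measure_pmf.prob ?M {E. ?X E \<le> \<mu> - s}"
    by (intro measure_Un_le) auto
  also have "\<dots> \<le> 2 * exp (- (w\<^sup>2 / 16))" using up low by simp
  finally show ?thesis by (simp add: prob_erdos_renyi)
qed

section \<open>Change of measure, level and power\<close>

text \<open>Cauchy-Schwarz applied to the indicator of \<open>A\<close> times the likelihood ratio.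
  The second moment of the ratio factorises over the edges, each factor being 1 plus the chi-square
  divergence of the two Bernoulli laws.\<close>

lemma prob_change_of_parameter:
  assumes p: "0 < p" "p < 1" and p0: "0 \<le> p0" "p0 \<le> 1"
  shows "(measure_pmf.prob (edge_pmf N (\<lambda>_. p0)) A)\<^sup>2 \<le>
    measure_pmf.prob (edge_pmf N (\<lambda>_. p)) A *
    exp (real (card (node_pairs N)) * ((p0 - p)\<^sup>2 / (p * (1 - p))))"
proof -
  let ?K = "node_pairs N"
  \<comment> \<open>A finite set containing the support for every parameter, so that all
    probabilities become sums over one index set.\<close>
  define U :: "(nat \<times> nat \<Rightarrow> bool) set" where "U = PiE_dflt ?K False (\<lambda>_. UNIV)"
  have U: "finite U" unfolding U_def using finite_node_pairs by (intro finite_PiE_dflt) auto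
  define f where "f q E = pmf (edge_pmf N (\<lambda>_. q)) E" for q :: real and E
  define g :: "bool \<Rightarrow> real" where "g b = (if b then p0 / p else (1 - p0) / (1 - p))" for b
  define LR where "LR E = (\<Prod>e\<in>?K. g (E e))" for E :: "nat \<times> nat \<Rightarrow> bool"
  have set: "set_pmf (edge_pmf N (\<lambda>_. q)) \<subseteq> U" for q
    unfolding U_def edge_pmf_def by (auto simp: set_Pi_pmf finite_node_pairs PiE_dflt_def)
  have f: "f p0 E = f p E * LR E" for E
  proof -
    have "pmf (bernoulli_pmf p0) b = pmf (bernoulli_pmf p) b * g b" for b
      using p p0 by (cases b) (auto simp: g_def)
    then show ?thesis
      unfolding f_def edge_pmf_def LR_def
      by (auto simp: pmf_Pi[OF finite_node_pairs] prod.distrib simp del: split_paired_All split_paired_Ex)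
  qed
  have f0: "0 \<le> f q E" for q E by (simp add: f_def)
  have prob: "measure_pmf.prob (edge_pmf N (\<lambda>_. q)) A = (\<Sum>E\<in>U. f q E * indicator A E)" for q
  proof -
    have "measure_pmf.prob (edge_pmf N (\<lambda>_. q)) A = measure_pmf.expectation (edge_pmf N (\<lambda>_. q)) (indicator A)"
      by simp
    also have "\<dots> = (\<Sum>E\<in>U. indicator A E * f q E)"
      unfolding f_def by (rule integral_measure_pmf_real[OF U]) (use set in auto)
    finally show ?thesis by (simp add: mult.commute)
  qed
  \<comment> \<open>Giving one square root of the mass to each factor turns the weighted
    Cauchy-Schwarz inequality into the one for plain sums.\<close>
  have *: "measure_pmf.prob (edge_pmf N (\<lambda>_. p0)) A =
     (\<Sum>E\<in>U. (sqrt (f p E) * indicator A E) * (sqrt (f p E) * LR E))"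
    unfolding prob
  proof (rule sum.cong[OF refl])
    fix E
    have "sqrt (f p E) * sqrt (f p E) = f p E" using f0 by simp
    then show "f p0 E * indicator A E = (sqrt (f p E) * indicator A E) * (sqrt (f p E) * LR E)"
      unfolding f by (metis mult.assoc mult.commute)
  qed
  have "(measure_pmf.prob (edge_pmf N (\<lambda>_. p0)) A)\<^sup>2 \<le>
     (\<Sum>E\<in>U. (sqrt (f p E) * indicator A E)\<^sup>2) * (\<Sum>E\<in>U. (sqrt (f p E) * LR E)\<^sup>2)"
    unfolding * by (rule Cauchy_Schwarz_ineq_sum)
  also have "(\<Sum>E\<in>U. (sqrt (f p E) * indicator A E)\<^sup>2) = measure_pmf.prob (edge_pmf N (\<lambda>_. p)) A"
    unfolding prob
    by (intro sum.cong refl) (use f0 in \<open>auto simp: power_mult_distrib indicator_def\<close>)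
  also have "(\<Sum>E\<in>U. (sqrt (f p E) * LR E)\<^sup>2) = measure_pmf.expectation (edge_pmf N (\<lambda>_. p)) (\<lambda>E. \<Prod>e\<in>?K. (g (E e))\<^sup>2)"
  proof -
    have "measure_pmf.expectation (edge_pmf N (\<lambda>_. p)) (\<lambda>E. \<Prod>e\<in>?K. (g (E e))\<^sup>2) =
        (\<Sum>E\<in>U. (\<Prod>e\<in>?K. (g (E e))\<^sup>2) * f p E)"
      unfolding f_def by (rule integral_measure_pmf_real[OF U]) (use set in auto)
    also have "\<dots> = (\<Sum>E\<in>U. (sqrt (f p E) * LR E)\<^sup>2)"
      by (intro sum.cong refl) (use f0 in \<open>simp add: power_mult_distrib LR_def prod_power_distrib mult.commute\<close>)
    finally show ?thesis ..
  qed
  also have "measure_pmf.expectation (edge_pmf N (\<lambda>_. p)) (\<lambda>E. \<Prod>e\<in>?K. (g (E e))\<^sup>2) =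
      (\<Prod>e\<in>?K. 1 + (p0 - p)\<^sup>2 / (p * (1 - p)))"
  proof -
    have "measure_pmf.expectation (edge_pmf N (\<lambda>_. p)) (\<lambda>E. \<Prod>e\<in>?K. (g (E e))\<^sup>2) =
       (\<Prod>e\<in>?K. measure_pmf.expectation (bernoulli_pmf p) (\<lambda>b. (g b)\<^sup>2))"
      unfolding edge_pmf_def
      by (rule expectation_prod_Pi_pmf[OF finite_node_pairs]) (auto intro: integrable_measure_pmf_finite)
    also have "measure_pmf.expectation (bernoulli_pmf p) (\<lambda>b. (g b)\<^sup>2) = 1 + (p0 - p)\<^sup>2 / (p * (1 - p))"
    proof -
      define r where "r = 1 - p"
      have r: "0 < r" "p = 1 - r" using p by (auto simp: r_def)
      show ?thesis
        using p r(1) by (simp add: g_def field_simps power2_eq_square flip: r_def)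
          (simp add: r(2) algebra_simps)
    qed
    finally show ?thesis .
  qed
  also have "\<dots> \<le> (\<Prod>e\<in>?K. exp ((p0 - p)\<^sup>2 / (p * (1 - p))))"
    using p by (intro prod_mono conjI exp_ge_add_one_self) auto
  also have "\<dots> = exp (real (card ?K) * ((p0 - p)\<^sup>2 / (p * (1 - p))))"
    by (simp only: prod_constant exp_of_nat_mult)
  finally show ?thesis by (simp add: mult_left_mono)
qed

text \<open>
  The random calibration parameter costs nothing more than a deterministic one: among the
  rejected graphs whose parameter lies in the window, the one with the smallest statistic
  determines a parameter \<open>p\<close> whose upper tail event contains all the others.
\<close>

lemma level_bound:
  assumes N: "1 \<le> N" and p0: "0 < p0" "p0 \<le> 1 / 4" and w: "0 \<le> w" "2 * w \<le> real N * sqrt p0"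
    and \<alpha>: "0 \<le> \<alpha>"
  shows "measure_pmf.prob (erdos_renyi N p0) {W. relaxed_scan_test N n pt \<alpha> W} \<le>
    measure_pmf.prob (erdos_renyi N p0) {W. w * sqrt p0 / real N < \<bar>pt W - p0\<bar>} + sqrt \<alpha> * exp (w\<^sup>2)"
proof -
  let ?M = "edge_pmf N (\<lambda>_. p0)"
  let ?f = "\<lambda>E. SDP n (adj_mat N E ^\<^sub>m 2)"
  define U where "U = {E \<in> set_pmf ?M. \<bar>pt (adj_mat N E) - p0\<bar> \<le> w * sqrt p0 / real N \<and>
     p_value N n (?f E) (pt (adj_mat N E)) \<le> \<alpha>}"
  have finU: "finite U" unfolding U_def using finite_set_edge_pmf by auto
  have U: "measure_pmf.prob ?M U \<le> sqrt \<alpha> * exp (w\<^sup>2)"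
  proof (cases "U = {}")
    case True
    then show ?thesis using \<alpha> by simp
  next
    case False
    define E0 where "E0 = arg_min_on ?f U"
    have E0: "E0 \<in> U" "\<And>E. E \<in> U \<Longrightarrow> ?f E0 \<le> ?f E"
      using arg_min_if_finite[OF finU False, of ?f] unfolding E0_def by (auto simp: not_less)
    define p where "p = pt (adj_mat N E0)"
    define d where "d = w * sqrt p0 / real N"
    have pd: "\<bar>p - p0\<bar> \<le> d" and pv: "p_value N n (?f E0) p \<le> \<alpha>"
      using E0(1) by (auto simp: U_def p_def d_def)
    \<comment> \<open>The window thus stays inside \<open>[p0 / 2, 1 / 2]\<close>, where
      \<open>p * (1 - p) \<ge> p0 / 4\<close>. The divergence is then at most
      \<open>4 * w^2 / N^2\<close> per edge, hence \<open>2 * w^2\<close> over at most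
      \<open>N^2 / 2\<close> edges.\<close>
    have "2 * d \<le> p0"
    proof -
      have "2 * w * sqrt p0 \<le> real N * sqrt p0 * sqrt p0"
        using w p0 by (intro mult_right_mono) auto
      then show ?thesis using N p0 by (simp add: d_def field_simps)
    qed
    then have p: "p0 / 2 \<le> p" "p \<le> 1 / 2" "0 < p" "p < 1" using pd p0 by linarith+
    have "(measure_pmf.prob ?M U)\<^sup>2 \<le> (measure_pmf.prob ?M {E. ?f E0 \<le> ?f E})\<^sup>2"
      by (intro power_mono measure_pmf.finite_measure_mono) (use E0(2) in auto)
    also have "\<dots> \<le> measure_pmf.prob (edge_pmf N (\<lambda>_. p)) {E. ?f E0 \<le> ?f E} *
        exp (real (card (node_pairs N)) * ((p0 - p)\<^sup>2 / (p * (1 - p))))"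
      by (rule prob_change_of_parameter) (use p p0 in auto)
    also have "\<dots> \<le> \<alpha> * exp (2 * w\<^sup>2)"
    proof (rule mult_mono)
      show "measure_pmf.prob (edge_pmf N (\<lambda>_. p)) {E. ?f E0 \<le> ?f E} \<le> \<alpha>"
        using pv by (simp add: p_value_eq)
      have "(p0 - p)\<^sup>2 \<le> d\<^sup>2" using pd by (simp add: abs_le_square_iff[symmetric] abs_minus_commute)
      moreover have "p0 / 2 * (1 / 2) \<le> p * (1 - p)" using p p0 by (intro mult_mono) auto
      ultimately have "(p0 - p)\<^sup>2 / (p * (1 - p)) \<le> d\<^sup>2 / (p0 / 2 * (1 / 2))"
        using p0 by (intro frac_le) auto
      also have "\<dots> = 4 * w\<^sup>2 / (real N)\<^sup>2"
        unfolding d_def using p0 N by (simp add: power_mult_distrib power_divide)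
      finally have *: "(p0 - p)\<^sup>2 / (p * (1 - p)) \<le> 4 * w\<^sup>2 / (real N)\<^sup>2" .
      have "real (card (node_pairs N)) * ((p0 - p)\<^sup>2 / (p * (1 - p))) \<le>
         (real N)\<^sup>2 / 2 * (4 * w\<^sup>2 / (real N)\<^sup>2)"
      proof (rule mult_mono)
        show "real (card (node_pairs N)) \<le> (real N)\<^sup>2 / 2"
          using real_card_node_pairs[OF N] by (simp add: power2_eq_square algebra_simps)
        show "0 \<le> (p0 - p)\<^sup>2 / (p * (1 - p))" using p by simp
      qed (use * in auto)
      also have "\<dots> = 2 * w\<^sup>2" using N by simp
      finally show "exp (real (card (node_pairs N)) * ((p0 - p)\<^sup>2 / (p * (1 - p)))) \<le> exp (2 * w\<^sup>2)"
        by simp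
    qed (use \<alpha> in auto)
    also have "\<dots> = (sqrt \<alpha> * exp (w\<^sup>2))\<^sup>2"
      using \<alpha> by (simp add: power_mult_distrib flip: exp_of_nat_mult)
    finally show ?thesis using \<alpha> by (simp add: power2_le_iff_abs_le)
  qed
  let ?B = "{E. w * sqrt p0 / real N < \<bar>pt (adj_mat N E) - p0\<bar>}"
  have "measure_pmf.prob ?M {E. relaxed_scan_test N n pt \<alpha> (adj_mat N E)} \<le> measure_pmf.prob ?M (?B \<union> U)"
    by (intro measure_pmf.finite_measure_mono_AE)
       (auto simp: AE_measure_pmf_iff U_def relaxed_scan_test_def)
  also have "\<dots> \<le> measure_pmf.prob ?M ?B + measure_pmf.prob ?M U"
    by (intro measure_Un_le) auto
  finally show ?thesis using U by (simp add: prob_erdos_renyi)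
qed

text \<open>A union bound: acceptance requires a small statistic or a calibration outside
  \<open>[0, p']\<close>. Uniformity of the p-value bound in \<open>p\<close> absorbs the dependence
  between \<open>pt W\<close> and the statistic.\<close>

lemma power_bound:
  assumes "measure_pmf.prob (planted N S p0 p1) {W. SDP n (W ^\<^sub>m 2) < L} \<le> a"
    and "measure_pmf.prob (planted N S p0 p1) {W. \<not> (0 \<le> pt W \<and> pt W \<le> p')} \<le> b"
    and "\<And>x p. L \<le> x \<Longrightarrow> 0 \<le> p \<Longrightarrow> p \<le> p' \<Longrightarrow> p_value N n x p \<le> \<alpha>"
  shows "measure_pmf.prob (planted N S p0 p1) {W. \<not> relaxed_scan_test N n pt \<alpha> W} \<le> a + b"
proof -
  let ?M = "planted N S p0 p1"
  have "measure_pmf.prob ?M {W. \<not> relaxed_scan_test N n pt \<alpha> W} \<le>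
    measure_pmf.prob ?M ({W. SDP n (W ^\<^sub>m 2) < L} \<union> {W. \<not> (0 \<le> pt W \<and> pt W \<le> p')})"
    using assms(3) by (intro measure_pmf.finite_measure_mono) (auto simp: relaxed_scan_test_def not_less)
  also have "\<dots> \<le> measure_pmf.prob ?M {W. SDP n (W ^\<^sub>m 2) < L} +
      measure_pmf.prob ?M {W. \<not> (0 \<le> pt W \<and> pt W \<le> p')}"
    by (intro measure_Un_le) auto
  finally show ?thesis using assms(1,2) by linarith
qed

text \<open>
  In this inequality \<open>p'\<close> is the largest calibration parameter. Its left-hand side bounds the
  statistic of \<open>G(N, p)\<close> for \<open>p \<le> p'\<close>, its right-hand side is the lower bound under the
  alternative. Every error term is compared with \<open>\<eta> m p0 sqrt (N r)\<close>, where \<open>r = ln N\<close>.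
\<close>

lemma threshold_inequality:
  fixes N m p0 p1 \<eta> w r :: real
  assumes m: "2 \<le> m" "m \<le> N" and p: "0 < p0" "p0 < p1" "p1 \<le> 1" and \<eta>: "0 < \<eta>" "\<eta> \<le> 1"
    and w: "1 \<le> w" "w \<le> sqrt r" "w \<le> N" and r: "1 \<le> r" "r \<le> N"
    and signal: "(2 + 2 * \<eta>) * p0 * sqrt (N * r) \<le> m * (p1 - p0)\<^sup>2"
    and c1: "75 * w \<le> \<eta> * p0 * sqrt (N * r)"
    and c2: "840 \<le> \<eta> * (m\<^sup>2 * p0)" "162 \<le> \<eta>\<^sup>2 * (m\<^sup>2 * p0)" and c3: "840 * p0 \<le> \<eta>"
    and c4: "2 * w / N \<le> p0" and p': "p' = p0 + 2 * w / N"
  shows "N * p' + 3 * sqrt (N * p' * r) + (m - 1) * (N * p'\<^sup>2 + (2 + \<eta>) * p' * sqrt (N * r)) <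
     (N - m) * (p0 + (m - 1) * p0\<^sup>2) - 70 * w * sqrt N * (1 + m * p0)\<^sup>2 / m
     + (m - 1)\<^sup>2 * p1\<^sup>2 - 4 * w * m"
proof -
  define g where "g = sqrt (N * r)"
  \<comment> \<open>The signal \<open>(2 + 2 * \<eta>) * H\<close> exceeds the codegree term
    \<open>(2 + \<eta>) * H\<close> by \<open>\<eta> * H\<close>. One third pays for the degree
    deviation (\<open>T2\<close>), one third for the fluctuation of the squares (\<open>L1\<close>),
    and one third for all terms of order \<open>w * m\<close>. The latter add up to at most 23 of
    the 25 units that \<open>c1\<close> provides.\<close>
  define H where "H = m * (p0 * g)"
  have N: "0 < N" "1 \<le> N" using m by auto
  have g0: "0 \<le> g" using N r by (simp add: g_def)
  have gsq: "g\<^sup>2 = N * r" using N r by (simp add: g_def)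
  have gN: "g \<le> N" unfolding g_def using N r by (intro real_le_lsqrt) (auto simp: power2_eq_square)
  have pp: "0 < p'" "p' \<le> 2 * p0" using p w N c4 unfolding p' by (auto intro!: add_pos_nonneg)
  have m0: "0 < m" using m by simp
  have wm: "w \<le> w * m" "m \<le> w * m" using w m mult_left_mono[of 1 m w] mult_right_mono[of 1 w m] by auto
  have T1: "N * p' = N * p0 + 2 * w" unfolding p' using N by (simp add: field_simps)
  \<comment> \<open>The constant \<open>162 = 2 * 81\<close> combines \<open>p' \<le> 2 * p0\<close>
    with the square of the target \<open>\<eta> / 9 * H\<close>.\<close>
  have T2: "3 * sqrt (N * p' * r) \<le> \<eta> / 3 * H"
  proof -
    have "N * p' * r \<le> N * (2 * p0) * r" using pp N r by (intro mult_right_mono mult_left_mono) auto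
    also have "\<dots> = 162 * (p0 * (N * r) / 81)" by simp
    also have "\<dots> \<le> \<eta>\<^sup>2 * (m\<^sup>2 * p0) * (p0 * (N * r) / 81)"
      using c2 p N r by (intro mult_right_mono) auto
    also have "\<dots> = (\<eta> / 9 * H)\<^sup>2"
      by (simp add: H_def power_mult_distrib gsq power_divide) (simp add: power2_eq_square)
    finally have "sqrt (N * p' * r) \<le> \<eta> / 9 * H"
      using \<eta> m p g0 by (intro real_le_lsqrt) (auto simp: H_def)
    then show ?thesis by simp
  qed
  have T3: "(m - 1) * (N * p'\<^sup>2) \<le> (m - 1) * (N * p0\<^sup>2) + 8 * (w * m)"
  proof -
    have "N * p'\<^sup>2 = N * p0\<^sup>2 + 4 * w * p0 + 4 * w * (w / N)"
      unfolding p' using N by (simp add: power2_eq_square field_simps)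
    also have "\<dots> \<le> N * p0\<^sup>2 + 4 * w * 1 + 4 * w * 1"
      using w p N by (intro add_mono mult_left_mono) auto
    finally have "(m - 1) * (N * p'\<^sup>2) \<le> (m - 1) * (N * p0\<^sup>2 + 8 * w)"
      using m by (intro mult_left_mono) auto
    also have "\<dots> \<le> (m - 1) * (N * p0\<^sup>2) + 8 * (w * m)" using w by (simp add: algebra_simps)
    finally show ?thesis .
  qed
  have T4: "(m - 1) * ((2 + \<eta>) * p' * g) \<le> (2 + \<eta>) * H + 6 * (w * m)"
  proof -
    have "(2 + \<eta>) * (w * (2 * (g / N))) \<le> 3 * (w * (2 * 1))"
      using \<eta> w gN N g0 by (intro mult_mono mult_nonneg_nonneg) auto
    then have "(2 + \<eta>) * p' * g \<le> (2 + \<eta>) * (p0 * g) + 6 * w"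
      unfolding p' by (simp add: algebra_simps)
    then have "(m - 1) * ((2 + \<eta>) * p' * g) \<le> m * ((2 + \<eta>) * (p0 * g) + 6 * w)"
      using m \<eta> pp g0 by (intro mult_mono) auto
    also have "\<dots> = (2 + \<eta>) * H + 6 * (w * m)" by (simp add: H_def algebra_simps)
    finally show ?thesis .
  qed
  \<comment> \<open>Both 1 and \<open>(m * p0)^2\<close> are at most
    \<open>\<eta> * m^2 * p0 / 840\<close>, so \<open>(1 + m * p0)^2\<close> is at most
    \<open>\<eta> * m^2 * p0 / 210\<close>; then \<open>70 / 210 = 1 / 3\<close>.\<close>
  have L1: "70 * w * sqrt N * (1 + m * p0)\<^sup>2 / m \<le> \<eta> / 3 * H"
  proof -
    have "(1 + m * p0)\<^sup>2 \<le> 2 * (1 + (m * p0)\<^sup>2)"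
      using zero_le_power2[of "1 - m * p0"] by (simp add: power2_eq_square algebra_simps)
    also have "\<dots> \<le> 2 * (\<eta> / 840 * (m\<^sup>2 * p0) + m\<^sup>2 * p0 * (\<eta> / 840))"
    proof -
      have "m\<^sup>2 * p0 * p0 \<le> m\<^sup>2 * p0 * (\<eta> / 840)"
        using c3 p by (intro mult_left_mono) auto
      then have "(m * p0)\<^sup>2 \<le> m\<^sup>2 * p0 * (\<eta> / 840)" by (simp add: power2_eq_square mult_ac)
      moreover have "1 \<le> \<eta> / 840 * (m\<^sup>2 * p0)" using c2(1) by simp
      ultimately show ?thesis by (intro mult_left_mono add_mono) simp_all
    qed
    also have "\<dots> = \<eta> / 210 * (m\<^sup>2 * p0)" by simp
    finally have "70 * w * sqrt N * (1 + m * p0)\<^sup>2 \<le> 70 * sqrt r * sqrt N * (\<eta> / 210 * (m\<^sup>2 * p0))"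
      using w N r by (intro mult_mono) auto
    also have "\<dots> = \<eta> / 3 * H * m"
      by (simp add: H_def g_def real_sqrt_mult power2_eq_square)
    finally show ?thesis using m0 by (simp add: field_simps)
  qed
  have L2: "(m - 1)\<^sup>2 * p1\<^sup>2 \<ge> m\<^sup>2 * p1\<^sup>2 - 2 * m"
  proof -
    have "(2 * m - 1) * p1\<^sup>2 \<le> 2 * m * 1"
      using m p by (intro mult_mono power_le_one) auto
    then show ?thesis by (simp add: power2_eq_square algebra_simps)
  qed
  have L3: "m\<^sup>2 * p1\<^sup>2 - m\<^sup>2 * p0\<^sup>2 \<ge> (2 + 2 * \<eta>) * H"
  proof -
    have "(p1 - p0)\<^sup>2 \<le> (p1 - p0) * (p1 + p0)"
      unfolding power2_eq_square using p by (intro mult_left_mono) auto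
    then have "m * (m * (p1 - p0)\<^sup>2) \<le> m * (m * (p1\<^sup>2 - p0\<^sup>2))"
      using m by (intro mult_left_mono) (auto simp: power2_eq_square algebra_simps)
    moreover have "m * ((2 + 2 * \<eta>) * p0 * g) \<le> m * (m * (p1 - p0)\<^sup>2)"
      using signal m unfolding g_def by (intro mult_left_mono) auto
    ultimately show ?thesis by (simp add: H_def power2_eq_square algebra_simps)
  qed
  have L4: "(N - m) * (p0 + (m - 1) * p0\<^sup>2) \<ge> N * p0 - m + (m - 1) * (N * p0\<^sup>2) - m\<^sup>2 * p0\<^sup>2"
  proof -
    have "m * p0 \<le> m * 1" using p m by (intro mult_left_mono) auto
    moreover have "0 \<le> m * p0\<^sup>2" using m by simp
    ultimately show ?thesis by (simp add: power2_eq_square algebra_simps)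
  qed
  have "25 * (w * m) \<le> \<eta> / 3 * H"
    using mult_right_mono[OF c1, of "m / 3"] m by (simp add: H_def g_def mult_ac)
  then have fin: "25 * (w * m) \<le> (\<eta> * H) / 3" by simp
  have wm0: "0 < w * m" using w m by simp
  have "N * p' + 3 * sqrt (N * p' * r) + (m - 1) * (N * p'\<^sup>2 + (2 + \<eta>) * p' * g)
     \<le> N * p0 + 2 * w + (\<eta> * H) / 3 + (m - 1) * (N * p0\<^sup>2) + 8 * (w * m) + 2 * H + \<eta> * H + 6 * (w * m)"
  proof -
    have "(m - 1) * (N * p'\<^sup>2 + (2 + \<eta>) * p' * g) = (m - 1) * (N * p'\<^sup>2) + (m - 1) * ((2 + \<eta>) * p' * g)"
      by (rule distrib_left)
    moreover have "(2 + \<eta>) * H = 2 * H + \<eta> * H" by (rule distrib_right)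
    moreover have "\<eta> / 3 * H = (\<eta> * H) / 3" by simp
    ultimately show ?thesis using T1 T2 T3 T4 by linarith
  qed
  also have "\<dots> < N * p0 - m + (m - 1) * (N * p0\<^sup>2) - m\<^sup>2 * p0\<^sup>2 - (\<eta> * H) / 3
      + (m\<^sup>2 * p1\<^sup>2 - 2 * m) - 4 * (w * m)"
  proof -
    have "(2 + 2 * \<eta>) * H = 2 * H + 2 * (\<eta> * H)" by (simp add: distrib_right)
    then show ?thesis using L3 fin wm wm0 by linarith
  qed
  also have "\<dots> \<le> (N - m) * (p0 + (m - 1) * p0\<^sup>2) - 70 * w * sqrt N * (1 + m * p0)\<^sup>2 / m
     + (m - 1)\<^sup>2 * p1\<^sup>2 - 4 * w * m"
    using L1 L2 L4 by simp
  finally show ?thesis by (simp add: g_def)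
qed

text \<open>The calibration enters only through \<open>null\<close> and \<open>alt\<close>, so that
  the true and the estimated parameter are treated alike. The thresholds \<open>s\<close> and
  \<open>u\<close> for degrees and codegrees give exponents \<open>3 * r\<close> and
  \<open>(2 + \<eta>) * r\<close>, which \<open>c8\<close> compares with the level.\<close>

lemma risk_bound:
  fixes N n :: nat and p0 p1 \<eta> w r \<alpha> :: real
  assumes n: "2 \<le> n" "n < N" and p: "0 < p0" "p0 < p1" "p1 \<le> 1" and \<eta>: "0 < \<eta>" "\<eta> \<le> 1"
    and w: "1 \<le> w" "w \<le> sqrt r" "w \<le> real N" and r: "1 \<le> r" "r \<le> real N"
    and signal: "(2 + 2 * \<eta>) * p0 * sqrt (real N * r) \<le> real n * (p1 - p0)\<^sup>2"
    and c1: "75 * w \<le> \<eta> * p0 * sqrt (real N * r)"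
    and c2: "840 \<le> \<eta> * ((real n)\<^sup>2 * p0)" "162 \<le> \<eta>\<^sup>2 * ((real n)\<^sup>2 * p0)" and c3: "840 * p0 \<le> \<eta>"
    and c4: "2 * w / real N \<le> p0" and c6: "2 * w \<le> real N * sqrt p0"
    and c7: "9 * sqrt r \<le> \<eta> * (sqrt (real N) * p0)"
    and c8: "real N * exp (- 3 * r) + (real N)\<^sup>2 * exp (- (2 + \<eta>) * r) \<le> \<alpha>"
    and null: "measure_pmf.prob (erdos_renyi N p0) {W. w * sqrt p0 / real N < \<bar>pt W - p0\<bar>} \<le> a"
    and alt: "\<And>S. S \<subseteq> {..<N} \<Longrightarrow> card S = n \<Longrightarrow>
        measure_pmf.prob (planted N S p0 p1) {W. \<not> (0 \<le> pt W \<and> pt W \<le> p0 + 2 * w / real N)} \<le> b"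
  shows "risk N n p0 p1 (relaxed_scan_test N n pt \<alpha>) \<le> a + sqrt \<alpha> * exp (w\<^sup>2) + (2 * exp (- (w\<^sup>2)) + b)"
proof -
  let ?N = "real N" and ?n = "real n"
  define p' where "p' = p0 + 2 * w / ?N"
  define L where "L = (?N - ?n) * (p0 + (?n - 1) * p0\<^sup>2)
      - 70 * w * sqrt ?N * (1 + ?n * p0)\<^sup>2 / ?n + (?n - 1)\<^sup>2 * p1\<^sup>2 - 4 * w * ?n"
  have N: "0 < ?N" using n by simp
  have p': "p0 \<le> p'" "0 < p'" "p' \<le> 1"
    using p w N c3 c4 \<eta> by (auto simp: p'_def intro!: add_pos_nonneg)
  have \<alpha>: "0 \<le> \<alpha>" using c8 by (rule order_trans[rotated]) simp
  have level: "measure_pmf.prob (erdos_renyi N p0) {W. relaxed_scan_test N n pt \<alpha> W} \<le> a + sqrt \<alpha> * exp (w\<^sup>2)"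
    using level_bound[of N p0 w \<alpha> n pt] null \<alpha> n p w c3 c6 \<eta> by linarith
  \<comment> \<open>Both deviations are now small against their means: \<open>s\<close> is at most a
    third and \<open>u\<close> at most a fraction \<open>\<eta> / 3\<close>. The correction factors
    of the tails are therefore at least \<open>2 / 3\<close> and
    \<open>1 - \<eta> / 3\<close>.\<close>
  have rN: "9 * sqrt r \<le> \<eta> * (sqrt ?N * p')"
  proof -
    have "\<eta> * (sqrt ?N * p0) \<le> \<eta> * (sqrt ?N * p')"
      using p' \<eta> by (intro mult_left_mono) auto
    then show ?thesis using c7 by linarith
  qed
  have rN2: "81 * r \<le> ?N * p'"
  proof -
    have "(9 * sqrt r)\<^sup>2 \<le> (\<eta> * (sqrt ?N * p'))\<^sup>2" using rN r by (intro power_mono) auto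
    then have "81 * r \<le> \<eta>\<^sup>2 * (?N * p'\<^sup>2)" using r by (simp add: power_mult_distrib)
    also have "\<dots> \<le> 1 * (?N * p')"
      using \<eta> p' N by (intro mult_mono power_le_one mult_left_mono) (auto simp: power2_eq_square mult_left_le)
    finally show ?thesis by simp
  qed
  have pv: "p_value N n x p \<le> \<alpha>" if x: "L \<le> x" and pp: "0 \<le> p" "p \<le> p'" for x p
  proof -
    define s where "s = 3 * sqrt (?N * p' * r)"
    define u where "u = (2 + \<eta>) * p' * sqrt (?N * r)"
    have s2: "s\<^sup>2 = 9 * (?N * p' * r)" unfolding s_def using N p' r by (simp add: power_mult_distrib)
    have s3: "3 * s \<le> ?N * p'"
    proof (rule power2_le_imp_le)
      have "(3 * s)\<^sup>2 = 81 * r * (?N * p')" by (simp add: power_mult_distrib s2)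
      also have "\<dots> \<le> (?N * p') * (?N * p')" using rN2 N p' by (intro mult_right_mono) auto
      finally show "(3 * s)\<^sup>2 \<le> (?N * p')\<^sup>2" by (simp add: power2_eq_square)
    qed (use N p' in simp)
    have s0: "0 \<le> s" using N p' r by (simp add: s_def)
    have u2: "u\<^sup>2 = (2 + \<eta>)\<^sup>2 * p'\<^sup>2 * (?N * r)" unfolding u_def using N r by (simp add: power_mult_distrib)
    have u0: "0 \<le> u" using N p' r \<eta> by (simp add: u_def)
    have u3: "3 * u \<le> \<eta> * (?N * p'\<^sup>2)"
    proof -
      have "3 * u \<le> 3 * (3 * p' * sqrt (?N * r))"
        unfolding u_def using \<eta> p' N r by (intro mult_left_mono mult_right_mono) auto
      also have "\<dots> = 9 * sqrt r * (p' * sqrt ?N)" by (simp add: real_sqrt_mult)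
      also have "\<dots> \<le> \<eta> * (sqrt ?N * p') * (p' * sqrt ?N)"
        using rN p' by (intro mult_right_mono) auto
      also have "\<dots> = \<eta> * (?N * p'\<^sup>2)"
        by (simp add: power2_eq_square mult_ac flip: real_sqrt_mult)
      finally show ?thesis .
    qed
    have u4: "u \<le> ?N * p'\<^sup>2"
    proof -
      have "\<eta> * (?N * p'\<^sup>2) \<le> 3 * (?N * p'\<^sup>2)" using \<eta> by (intro mult_right_mono) auto
      then show ?thesis using u3 by linarith
    qed
    have "?N * p' + s + (?n - 1) * (?N * p'\<^sup>2 + u) < L"
      unfolding L_def s_def u_def
      by (rule threshold_inequality[where ?p0.0 = p0 and ?p1.0 = p1 and \<eta> = \<eta> and w = w and r = r])
         (use n p \<eta> w r signal c1 c2 c3 c4 in \<open>auto simp: p'_def\<close>)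
    then have "p_value N n x p \<le>
      ?N * exp (- (s\<^sup>2 / (2 * (?N * p'))) * (1 - s / (?N * p'))) +
      ?N\<^sup>2 * exp (- (u\<^sup>2 / (2 * (?N * p'\<^sup>2))) * (1 - u / (?N * p'\<^sup>2)))"
      using n pp p' s0 s3 u0 u4 x by (intro p_value_le) auto
    also have "\<dots> \<le> ?N * exp (- 3 * r) + ?N\<^sup>2 * exp (- (2 + \<eta>) * r)"
    proof (intro add_mono mult_left_mono)
      have "s / (?N * p') \<le> 1 / 3" using s3 N p' by (simp add: field_simps)
      then have "9 * r / 2 * (2 / 3) \<le> 9 * r / 2 * (1 - s / (?N * p'))"
        using r by (intro mult_left_mono) auto
      moreover have eq: "s\<^sup>2 / (2 * (?N * p')) = 9 * r / 2" unfolding s2 using N p' by simp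
      ultimately show "exp (- (s\<^sup>2 / (2 * (?N * p'))) * (1 - s / (?N * p'))) \<le> exp (- 3 * r)"
        unfolding eq by simp
      have "u / (?N * p'\<^sup>2) \<le> \<eta> / 3" using u3 N p' by (simp add: field_simps)
      then have "(2 + \<eta>)\<^sup>2 * r / 2 * (1 - \<eta> / 3) \<le> (2 + \<eta>)\<^sup>2 * r / 2 * (1 - u / (?N * p'\<^sup>2))"
        using r by (intro mult_left_mono) auto
      moreover have "(2 + \<eta>) * r \<le> (2 + \<eta>)\<^sup>2 * r / 2 * (1 - \<eta> / 3)"
      proof -
        have "\<eta>\<^sup>2 \<le> \<eta>" using \<eta> by (simp add: power2_eq_square mult_left_le)
        \<comment> \<open>The product expands to \<open>1 + (\<eta> - \<eta>^2) / 6\<close>: the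
          surplus in the threshold outweighs the correction factor.\<close>
        then have "1 \<le> (2 + \<eta>) / 2 * (1 - \<eta> / 3)" using \<eta> by (simp add: power2_eq_square field_simps)
        then have "(2 + \<eta>) * r * 1 \<le> (2 + \<eta>) * r * ((2 + \<eta>) / 2 * (1 - \<eta> / 3))"
          using \<eta> r by (intro mult_left_mono) auto
        then show ?thesis by (simp add: power2_eq_square algebra_simps)
      qed
      moreover have eq: "u\<^sup>2 / (2 * (?N * p'\<^sup>2)) = (2 + \<eta>)\<^sup>2 * r / 2" unfolding u2 using N p' by simp
      ultimately have "(2 + \<eta>) * r \<le> u\<^sup>2 / (2 * (?N * p'\<^sup>2)) * (1 - u / (?N * p'\<^sup>2))"
        unfolding eq by linarith
      then show "exp (- (u\<^sup>2 / (2 * (?N * p'\<^sup>2))) * (1 - u / (?N * p'\<^sup>2))) \<le> exp (- (2 + \<eta>) * r)"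
        by (simp only: exp_le_cancel_iff mult_minus_left neg_le_iff_le)
    qed auto
    also have "\<dots> \<le> \<alpha>" by (rule c8)
    finally show ?thesis .
  qed
  have power: "measure_pmf.prob (planted N S p0 p1) {W. \<not> relaxed_scan_test N n pt \<alpha> W} \<le> 2 * exp (- (w\<^sup>2)) + b"
    if S: "S \<subseteq> {..<N}" "card S = n" for S
  proof (rule power_bound[where p' = p' and L = L])
    show "measure_pmf.prob (planted N S p0 p1) {W. SDP n (W ^\<^sub>m 2) < L} \<le> 2 * exp (- (w\<^sup>2))"
      by (rule planted_SDP_lower[OF S]) (use n p w in \<open>auto simp: L_def\<close>)
    show "measure_pmf.prob (planted N S p0 p1) {W. \<not> (0 \<le> pt W \<and> pt W \<le> p')} \<le> b"
      unfolding p'_def by (rule alt[OF S])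
  qed (use pv in auto)
  have "{..<n} \<in> {S. S \<subseteq> {..<N} \<and> card S = n}" using n by auto
  moreover have "finite {S. S \<subseteq> {..<N} \<and> card S = n}" by simp
  ultimately have "Max ((\<lambda>S. measure_pmf.prob (planted N S p0 p1) {W. \<not> relaxed_scan_test N n pt \<alpha> W}) `
      {S. S \<subseteq> {..<N} \<and> card S = n}) \<le> 2 * exp (- (w\<^sup>2)) + b"
    using power by (subst Max_le_iff) (blast, blast, auto)
  then show ?thesis using level unfolding risk_def by linarith
qed

section \<open>Asymptotics\<close>

lemma risk_nonneg:
  assumes "n \<le> N"
  shows "0 \<le> risk N n p0 p1 T"
proof -
  have "{..<n} \<in> {S. S \<subseteq> {..<N} \<and> card S = n}" using assms by auto
  then have "0 \<le> Max ((\<lambda>S. measure_pmf.prob (planted N S p0 p1) {W. \<not> T W}) ` {S. S \<subseteq> {..<N} \<and> card S = n})"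
    by (intro order_trans[OF _ Max_ge[OF _ imageI[where x = "{..<n}"]]]) auto
  then show ?thesis unfolding risk_def by (intro add_nonneg_nonneg) auto
qed

theorem proposition6:
  fixes n :: "nat \<Rightarrow> nat" and p0 p1 :: "nat \<Rightarrow> real" and t :: real
  assumes "\<And>N. 0 < p0 N" and "\<And>N. p0 N < p1 N" and "\<And>N. p1 N \<le> 1"
    and "(\<lambda>N. real (n N) / real N) \<longlonglongrightarrow> 0"
    and "\<exists>c<1. \<forall>N. p0 N \<le> c"
    and "filterlim (\<lambda>N. (real N)^2 * p0 N) at_top sequentially"
    and "filterlim n at_top sequentially"
    and "filterlim (\<lambda>N. (real (n N))^2 * p1 N) at_top sequentially"
    and "(\<lambda>N. ln (max 1 (1 / (real (n N) * p0 N)))) \<in> o(\<lambda>N. ln (real N / real (n N)))"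
    and "t > 0"
    and "\<forall>\<^sub>F N in sequentially. real (n N) \<le> real N powr (1/2 - t)"
    and "liminf (\<lambda>N. ereal (real (n N) / sqrt (real N * ln (real N))
                         * ((p1 N - p0 N)^2 / p0 N))) > 2"
  shows
    "(\<exists>\<alpha>. (\<forall>N. 0 < \<alpha> N \<and> \<alpha> N < 1) \<and>
        (\<lambda>N. risk N (n N) (p0 N) (p1 N)
               (relaxed_scan_test N (n N) (\<lambda>W. p0 N) (\<alpha> N))) \<longlonglongrightarrow> 0) \<and>
     (\<exists>\<alpha>. (\<forall>N. 0 < \<alpha> N \<and> \<alpha> N < 1) \<and>
        (\<lambda>N. risk N (n N) (p0 N) (p1 N)
               (relaxed_scan_test N (n N) (p_hat N) (\<alpha> N))) \<longlonglongrightarrow> 0)"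
proof -
  note p = assms(1-3) and t = assms(10)
  define r where "r N = ln (real N)" for N
  \<comment> \<open>It diverges, so the concentration errors vanish, while
    \<open>exp ((w N)^2)\<close> grows more slowly than any power of \<open>N\<close>.\<close>
  define w where "w N = sqrt (sqrt (r N))" for N
  \<comment> \<open>The bound \<open>t / 2\<close> is used for \<open>Np0\<close>; the bound
    \<open>1 / 16\<close> gives \<open>1/2 - 3 * \<epsilon> \<ge> 1/4\<close> in
    \<open>n2p0\<close>.\<close>
  define \<epsilon> where "\<epsilon> = min (t / 2) (1 / 16)"
  have \<epsilon>: "0 < \<epsilon>" "\<epsilon> \<le> t / 2" "\<epsilon> \<le> 1 / 16" using t by (auto simp: \<epsilon>_def)

  \<comment> \<open>A constant strictly between 2 and the limit inferior; \<open>\<eta>\<close> is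
    then chosen so that \<open>2 + 2 * \<eta> \<le> c\<close>.\<close>
  obtain c :: real where c: "2 < c"
    "ereal c < liminf (\<lambda>N. ereal (real (n N) / sqrt (real N * ln (real N)) * ((p1 N - p0 N)^2 / p0 N)))"
    using ereal_dense2[OF assms(12)] by auto
  define \<eta> where "\<eta> = min 1 ((c - 2) / 2)"
  have \<eta>: "0 < \<eta>" "\<eta> \<le> 1" using c(1) by (simp_all add: \<eta>_def)
  have \<eta>c: "\<eta> \<le> (c - 2) / 2" unfolding \<eta>_def by (rule min.cobounded2)

  \<comment> \<open>Polynomial bounds on the parameters\<close>
  have large: "\<forall>\<^sub>F N in sequentially. 3 \<le> N \<and> 1 \<le> r N \<and> r N \<le> real N"
    unfolding r_def by (intro eventually_conj eventually_ge_at_top) real_asymp+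
  have n2: "\<forall>\<^sub>F N in sequentially. 2 \<le> n N"
    using assms(7) by (simp add: filterlim_at_top)
  have nN: "\<forall>\<^sub>F N in sequentially. (real (n N))\<^sup>2 \<le> real N - 1 \<and> n N < N"
  proof -
    have "\<forall>\<^sub>F N in sequentially. real N * real N powr (- (2 * t)) \<le> real N - 1"
      using t by real_asymp
    with assms(11) large n2 show ?thesis
    proof eventually_elim
      case (elim N)
      have "(real (n N))\<^sup>2 \<le> (real N powr (1/2 - t))\<^sup>2" using elim by (intro power_mono) auto
      also have "\<dots> = real N * real N powr (- (2 * t))"
        unfolding power2_eq_square powr_add[symmetric] powr_mult_base[OF of_nat_0_le_iff]
        by (rule arg_cong[where f = "\<lambda>x. real N powr x"]) simp
      also have "\<dots> \<le> real N - 1" using elim by simp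
      finally have *: "(real (n N))\<^sup>2 \<le> real N - 1" .
      have "real (n N) * 1 \<le> real (n N) * real (n N)" using elim by (intro mult_left_mono) auto
      then have "real (n N) \<le> (real (n N))\<^sup>2" by (simp add: power2_eq_square)
      with * show ?case by linarith
    qed
  qed
  have signal: "\<forall>\<^sub>F N in sequentially.
      (2 + 2 * \<eta>) * p0 N * sqrt (real N * r N) \<le> real (n N) * (p1 N - p0 N)\<^sup>2"
    using less_LiminfD[OF c(2)] large
  proof eventually_elim
    case (elim N)
    have "c < real (n N) / sqrt (real N * r N) * ((p1 N - p0 N)\<^sup>2 / p0 N)" using elim by (simp add: r_def)
    moreover have "0 < sqrt (real N * r N)" using elim by simp
    ultimately have "c * (p0 N * sqrt (real N * r N)) < real (n N) * (p1 N - p0 N)\<^sup>2"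
      using p(1)[of N] by (simp add: field_simps)
    moreover have "(2 + 2 * \<eta>) * (p0 N * sqrt (real N * r N)) \<le> c * (p0 N * sqrt (real N * r N))"
      using \<eta>c p(1)[of N] elim by (intro mult_right_mono) (auto simp: field_simps)
    ultimately show ?case by (simp add: mult.assoc)
  qed
  \<comment> \<open>As \<open>(p1 - p0)^2 \<le> 1\<close>, the signal condition itself limits
    \<open>p0\<close>. Together with \<open>n \<le> N powr (1/2 - t)\<close> this makes
    \<open>p0\<close> polynomially small.\<close>
  have p0_n: "\<forall>\<^sub>F N in sequentially. p0 N * sqrt (real N) \<le> real (n N)"
    using signal large
  proof eventually_elim
    case (elim N)
    have "p0 N * sqrt (real N * 1) \<le> p0 N * sqrt (real N * r N)"
      using elim p(1)[of N] by (intro mult_left_mono real_sqrt_le_mono) auto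
    also have "\<dots> \<le> (2 + 2 * \<eta>) * (p0 N * sqrt (real N * r N))"
      using mult_right_mono[of 1 "2 + 2 * \<eta>" "p0 N * sqrt (real N * r N)"] \<eta> p(1)[of N] elim by simp
    also have "\<dots> \<le> real (n N) * (p1 N - p0 N)\<^sup>2" using elim by (simp add: mult.assoc)
    also have "\<dots> \<le> real (n N) * 1"
      using p(1-3)[of N] by (intro mult_left_mono power_le_one) auto
    finally show ?case by simp
  qed
  have p0_small: "\<forall>\<^sub>F N in sequentially. p0 N \<le> real N powr (- t)"
    using p0_n assms(11) large
  proof eventually_elim
    case (elim N)
    have "p0 N * sqrt (real N) \<le> real N powr (1/2 - t)" using elim by simp
    also have "\<dots> = real N powr (- t) * sqrt (real N)"
      using elim by (simp add: powr_half_sqrt[symmetric] flip: powr_add)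
    finally show ?case using elim by simp
  qed
  \<comment> \<open>The little-o hypothesis with constant \<open>\<epsilon>\<close> gives
    \<open>1 / (n p0) \<le> (N / n) powr \<epsilon>\<close>, and \<open>n \<ge> 1\<close> allows
    \<open>N\<close> in place of \<open>N / n\<close>.\<close>
  have np0: "\<forall>\<^sub>F N in sequentially. real N powr (- \<epsilon>) \<le> real (n N) * p0 N"
    using landau_o.smallD[OF assms(9) \<epsilon>(1)] n2 nN large
  proof eventually_elim
    case (elim N)
    let ?m = "max 1 (1 / (real (n N) * p0 N))"
    have np: "0 < real (n N) * p0 N" using elim p(1)[of N] by simp
    have "ln ?m \<le> \<epsilon> * ln (real N / real (n N))"
      using elim by (simp add: ln_div)
    also have "\<dots> \<le> \<epsilon> * ln (real N)"
      using elim \<epsilon> by (intro mult_left_mono ln_mono) (auto simp: field_simps)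
    finally have "ln ?m \<le> ln (real N powr \<epsilon>)" using elim by (simp add: ln_powr)
    then have "?m \<le> real N powr \<epsilon>" using elim by (subst (asm) ln_le_cancel_iff) auto
    then have "1 / (real (n N) * p0 N) \<le> real N powr \<epsilon>" by simp
    then show ?case using np elim by (simp add: powr_minus field_simps)
  qed
  have Np0: "\<forall>\<^sub>F N in sequentially. real N powr (t / 2) \<le> sqrt (real N) * p0 N"
    using np0 assms(11) large
  proof eventually_elim
    case (elim N)
    have "real N powr (t / 2 - 1/2) * real N powr (1/2 - t) \<le> real N powr (- \<epsilon>)"
      unfolding powr_add[symmetric] using \<epsilon> elim by (intro powr_mono) auto
    also have "\<dots> \<le> real N powr (1/2 - t) * p0 N"
      using elim p(1)[of N] by (meson mult_right_mono order_trans less_imp_le)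
    finally have "real N powr (t / 2 - 1/2) \<le> p0 N" using elim by (simp add: mult.commute)
    then have "sqrt (real N) * real N powr (t / 2 - 1/2) \<le> sqrt (real N) * p0 N"
      by (intro mult_left_mono) auto
    then show ?case using elim by (simp add: powr_half_sqrt[symmetric] flip: powr_add)
  qed
  \<comment> \<open>Write \<open>(n^2 p0)^2 = n * n * (n p0)^2\<close> and replace one
    \<open>n\<close> by \<open>p0 sqrt N\<close> through \<open>p0_n\<close>. This leaves
    \<open>sqrt N * (n p0)^3\<close>, to which \<open>np0\<close> applies.\<close>
  have n2p0: "\<forall>\<^sub>F N in sequentially. real N powr (1 / 8) \<le> (real (n N))\<^sup>2 * p0 N"
    using np0 p0_n large
  proof eventually_elim
    case (elim N)
    let ?x = "real (n N) * p0 N"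
    have x: "0 \<le> ?x" using p(1)[of N] by simp
    have "(real N powr (1 / 8))\<^sup>2 \<le> real N powr (- \<epsilon>) * real N powr (1/2) * (real N powr (- \<epsilon>))\<^sup>2"
      unfolding power2_eq_square powr_add[symmetric] using \<epsilon> elim by (intro powr_mono) auto
    also have "\<dots> \<le> ?x * real N powr (1/2) * ?x\<^sup>2"
      using elim x by (intro mult_mono power_mono) auto
    also have "\<dots> = real (n N) * (p0 N * sqrt (real N)) * ?x\<^sup>2"
      using elim by (simp add: powr_half_sqrt)
    also have "\<dots> \<le> real (n N) * real (n N) * ?x\<^sup>2"
      using elim by (intro mult_right_mono mult_left_mono) auto
    also have "\<dots> = ((real (n N))\<^sup>2 * p0 N)\<^sup>2" by (simp add: power2_eq_square)
    finally show ?case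
      by (rule power2_le_imp_le) (use p(1)[of N] in simp)
  qed

  \<comment> \<open>The left side is \<open>N powr -2 + N powr -\<eta>\<close>; halving the exponent
    absorbs the constants. The shift by 2 keeps the level strictly between 0 and 1 for every
    \<open>N\<close>, including 0 and 1.\<close>
  have \<alpha>_large: "\<forall>\<^sub>F N in sequentially. real N * exp (- 3 * r N) + (real N)\<^sup>2 * exp (- (2 + \<eta>) * r N)
      \<le> (real N + 2) powr (- (\<eta> / 2))"
  proof -
    have "\<forall>\<^sub>F N in sequentially. real N * exp (- 3 * ln (real N)) \<le> 1 / 2 * (real N + 2) powr (- (1 / 2))"
      by real_asymp
    moreover have "\<forall>\<^sub>F N in sequentially. (real N)\<^sup>2 * exp (- (2 + \<eta>) * ln (real N)) \<le> 1 / 2 * (real N + 2) powr (- (\<eta> / 2))"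
      using \<eta>(1) by real_asymp
    ultimately show ?thesis
    proof eventually_elim
      case (elim N)
      have "(real N + 2) powr (- (1 / 2)) \<le> (real N + 2) powr (- (\<eta> / 2))"
        using \<eta> by (intro powr_mono) auto
      then show ?case using elim unfolding r_def by linarith
    qed
  qed
  have \<alpha>_small: "(\<lambda>N. sqrt ((real N + 2) powr (- (\<eta> / 2))) * exp (sqrt (ln (real N)))) \<longlonglongrightarrow> 0"
    using \<eta>(1) by real_asymp

  have rates: "\<forall>\<^sub>F N in sequentially. 75 \<le> \<eta> * real N powr (t / 2) \<and> 840 \<le> \<eta> * real N powr (1 / 8) \<and>
     162 \<le> \<eta>\<^sup>2 * real N powr (1 / 8) \<and> 840 * real N powr (- t) \<le> \<eta> \<and>
     2 * w N \<le> sqrt (real N) * real N powr (t / 2) \<and> 9 * sqrt (r N) \<le> \<eta> * real N powr (t / 2) \<and>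
     w N \<le> real N / 2"
    unfolding w_def r_def using \<eta>(1) t by (intro eventually_conj) real_asymp+

  have w4: "(w N)\<^sup>2 = sqrt (ln (real N))" if "3 \<le> N" for N
    using that by (simp add: w_def r_def)
  have good: "\<forall>\<^sub>F N in sequentially. 3 \<le> N \<and> 2 \<le> n N \<and> n N < N \<and> (real (n N))\<^sup>2 \<le> real N - 1 \<and>
     1 \<le> w N \<and> w N \<le> sqrt (r N) \<and> w N \<le> real N \<and> w N \<le> real N / 2 \<and> 1 \<le> r N \<and> r N \<le> real N \<and>
     75 * w N \<le> \<eta> * p0 N * sqrt (real N * r N) \<and>
     840 \<le> \<eta> * ((real (n N))\<^sup>2 * p0 N) \<and> 162 \<le> \<eta>\<^sup>2 * ((real (n N))\<^sup>2 * p0 N) \<and> 840 * p0 N \<le> \<eta> \<and>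
     2 * w N / real N \<le> p0 N \<and> 2 * w N \<le> real N * sqrt (p0 N) \<and>
     9 * sqrt (r N) \<le> \<eta> * (sqrt (real N) * p0 N)"
    using large n2 nN p0_small Np0 n2p0 rates
  proof eventually_elim
    case (elim N)
    have N: "0 < real N" and r: "1 \<le> r N" using elim by auto
    have w1: "1 \<le> w N" using r by (simp add: w_def)
    have wr: "w N \<le> sqrt (r N)"
    proof -
      have "sqrt (r N) \<le> r N" using r by (intro real_le_lsqrt) (auto simp: power2_eq_square)
      then show ?thesis by (simp add: w_def)
    qed
    have \<eta>N: "\<eta> * real N powr (t / 2) \<le> \<eta> * (sqrt (real N) * p0 N)"
      using elim \<eta> by (intro mult_left_mono) auto
    have "75 * w N \<le> (\<eta> * (sqrt (real N) * p0 N)) * sqrt (r N)"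
      using elim wr w1 \<eta>N by (intro mult_mono) auto
    then have 1: "75 * w N \<le> \<eta> * p0 N * sqrt (real N * r N)"
      by (simp add: real_sqrt_mult mult_ac)
    have "\<eta> * real N powr (1 / 8) \<le> \<eta> * ((real (n N))\<^sup>2 * p0 N)"
      "\<eta>\<^sup>2 * real N powr (1 / 8) \<le> \<eta>\<^sup>2 * ((real (n N))\<^sup>2 * p0 N)"
      using elim \<eta> by (auto intro!: mult_left_mono)
    then have 2: "840 \<le> \<eta> * ((real (n N))\<^sup>2 * p0 N)" "162 \<le> \<eta>\<^sup>2 * ((real (n N))\<^sup>2 * p0 N)"
      using elim by linarith+
    have 3: "840 * p0 N \<le> \<eta>" using elim by linarith
    have "2 * w N \<le> sqrt (real N) * (sqrt (real N) * p0 N)"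
    proof -
      have "sqrt (real N) * real N powr (t / 2) \<le> sqrt (real N) * (sqrt (real N) * p0 N)"
        using elim by (intro mult_left_mono) auto
      then show ?thesis using elim by linarith
    qed
    then have 4: "2 * w N \<le> real N * p0 N" by (simp flip: mult.assoc)
    then have 5: "2 * w N / real N \<le> p0 N" using N by (simp add: field_simps)
    have "p0 N \<le> sqrt (p0 N)"
      using p[of N] by (intro real_le_rsqrt) (auto simp: power2_eq_square mult_left_le)
    then have "real N * p0 N \<le> real N * sqrt (p0 N)" using N by (intro mult_left_mono) auto
    then have 6: "2 * w N \<le> real N * sqrt (p0 N)" using 4 by linarith
    show ?case using elim w1 wr 1 2 3 5 6 \<eta>N N by auto
  qed

  \<comment> \<open>Stated for an arbitrary calibration \<open>pt\<close>, to be instantiated with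
    the constant \<open>p0 N\<close> and with \<open>p_hat N\<close>.\<close>
  have main: "\<exists>\<alpha>. (\<forall>N. 0 < \<alpha> N \<and> \<alpha> N < 1) \<and>
      (\<lambda>N. risk N (n N) (p0 N) (p1 N) (relaxed_scan_test N (n N) (pt N) (\<alpha> N))) \<longlonglongrightarrow> 0"
    if null: "\<forall>\<^sub>F N in sequentially. measure_pmf.prob (erdos_renyi N (p0 N))
        {W. w N * sqrt (p0 N) / real N < \<bar>pt N W - p0 N\<bar>} \<le> 2 * exp (- ((w N)\<^sup>2 / 16))"
      and alt: "\<forall>\<^sub>F N in sequentially. \<forall>S. S \<subseteq> {..<N} \<longrightarrow> card S = n N \<longrightarrow>
        measure_pmf.prob (planted N S (p0 N) (p1 N))
          {W. \<not> (0 \<le> pt N W \<and> pt N W \<le> p0 N + 2 * w N / real N)} \<le> exp (- ((w N)\<^sup>2 / 32))"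
    for pt :: "nat \<Rightarrow> real mat \<Rightarrow> real"
  proof (intro exI conjI allI)
    let ?\<alpha> = "\<lambda>N. (real N + 2) powr (- (\<eta> / 2))"
    let ?R = "\<lambda>N. risk N (n N) (p0 N) (p1 N) (relaxed_scan_test N (n N) (pt N) (?\<alpha> N))"
    let ?U = "\<lambda>N. 2 * exp (- (sqrt (ln (real N)) / 16)) + sqrt (?\<alpha> N) * exp (sqrt (ln (real N))) +
        (2 * exp (- (sqrt (ln (real N)))) + exp (- (sqrt (ln (real N)) / 32)))"
    show "0 < ?\<alpha> N" for N by simp
    show "?\<alpha> N < 1" for N using \<eta> by (simp add: powr_minus_divide)
    show "?R \<longlonglongrightarrow> 0"
    proof (rule tendsto_sandwich[where f = "\<lambda>_. 0" and h = ?U])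
      show "\<forall>\<^sub>F N in sequentially. 0 \<le> ?R N"
        using nN by eventually_elim (auto intro: risk_nonneg)
      show "\<forall>\<^sub>F N in sequentially. ?R N \<le> ?U N"
        using good signal null alt \<alpha>_large
      proof eventually_elim
        case (elim N)
        have "?R N \<le> 2 * exp (- ((w N)\<^sup>2 / 16)) + sqrt (?\<alpha> N) * exp ((w N)\<^sup>2) +
            (2 * exp (- ((w N)\<^sup>2)) + exp (- ((w N)\<^sup>2 / 32)))"
          by (rule risk_bound[where \<eta> = \<eta> and r = "r N"]) (use elim p \<eta> in auto)
        then show ?case using elim by (simp add: w4)
      qed
      have "(\<lambda>N. 2 * exp (- (sqrt (ln (real N)) / 16)) :: real) \<longlonglongrightarrow> 0"
        "(\<lambda>N. 2 * exp (- (sqrt (ln (real N)))) + exp (- (sqrt (ln (real N)) / 32)) :: real) \<longlonglongrightarrow> 0"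
        by real_asymp+
      from tendsto_add[OF tendsto_add[OF this(1) \<alpha>_small] this(2)] show "?U \<longlonglongrightarrow> 0" by simp
    qed simp
  qed

  have w0: "0 \<le> w N" if "3 \<le> N" for N using that by (simp add: w_def r_def)
  have "\<exists>\<alpha>. (\<forall>N. 0 < \<alpha> N \<and> \<alpha> N < 1) \<and>
      (\<lambda>N. risk N (n N) (p0 N) (p1 N) (relaxed_scan_test N (n N) (\<lambda>W. p0 N) (\<alpha> N))) \<longlonglongrightarrow> 0"
  proof (rule main)
    show "\<forall>\<^sub>F N in sequentially. measure_pmf.prob (erdos_renyi N (p0 N))
        {W. w N * sqrt (p0 N) / real N < \<bar>p0 N - p0 N\<bar>} \<le> 2 * exp (- ((w N)\<^sup>2 / 16))"
      using large
    proof eventually_elim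
      case (elim N)
      then have "0 \<le> w N * sqrt (p0 N) / real N" using w0[of N] p(1)[of N] by simp
      then show ?case by simp
    qed
    show "\<forall>\<^sub>F N in sequentially. \<forall>S. S \<subseteq> {..<N} \<longrightarrow> card S = n N \<longrightarrow>
        measure_pmf.prob (planted N S (p0 N) (p1 N))
          {W. \<not> (0 \<le> p0 N \<and> p0 N \<le> p0 N + 2 * w N / real N)} \<le> exp (- ((w N)\<^sup>2 / 32))"
      using large
    proof eventually_elim
      case (elim N)
      then have "0 \<le> p0 N \<and> p0 N \<le> p0 N + 2 * w N / real N" using w0[of N] p(1)[of N] by simp
      then show ?case by simp
    qed
  qed
  moreover have "\<exists>\<alpha>. (\<forall>N. 0 < \<alpha> N \<and> \<alpha> N < 1) \<and>
      (\<lambda>N. risk N (n N) (p0 N) (p1 N) (relaxed_scan_test N (n N) (p_hat N) (\<alpha> N))) \<longlonglongrightarrow> 0"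
  proof (rule main)
    show "\<forall>\<^sub>F N in sequentially. measure_pmf.prob (erdos_renyi N (p0 N))
        {W. w N * sqrt (p0 N) / real N < \<bar>p_hat N W - p0 N\<bar>} \<le> 2 * exp (- ((w N)\<^sup>2 / 16))"
      using good
    proof eventually_elim
      case (elim N)
      then show ?case using p[of N] by (intro null_p_hat) auto
    qed
    show "\<forall>\<^sub>F N in sequentially. \<forall>S. S \<subseteq> {..<N} \<longrightarrow> card S = n N \<longrightarrow>
        measure_pmf.prob (planted N S (p0 N) (p1 N))
          {W. \<not> (0 \<le> p_hat N W \<and> p_hat N W \<le> p0 N + 2 * w N / real N)} \<le> exp (- ((w N)\<^sup>2 / 32))"
      using good
    proof eventually_elim
      case (elim N)
      show ?case
      proof (intro allI impI)
        fix S assume S: "S \<subseteq> {..<N}" "card S = n N"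
        have "measure_pmf.prob (planted N S (p0 N) (p1 N)) {W. p0 N + 2 * w N / real N < p_hat N W}
            \<le> exp (- ((w N)\<^sup>2 / 32))"
          using elim p[of N] by (intro planted_p_hat_upper[OF S]) auto
        then show "measure_pmf.prob (planted N S (p0 N) (p1 N))
          {W. \<not> (0 \<le> p_hat N W \<and> p_hat N W \<le> p0 N + 2 * w N / real N)} \<le> exp (- ((w N)\<^sup>2 / 32))"
          \<comment> \<open>In terms of edge indicators only adjacency matrices occur, and on these
            the estimate is nonnegative, so only the upper deviation remains.\<close>
          unfolding prob_planted using elim by (simp add: p_hat_nonneg not_le)
      qed
    qed
  qed
  ultimately show ?thesis by blast
qed

end
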